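(* Let $A$ be an operator in $M_n(L^\infty(\mu))$ and suppose $\{A\}'\cap M_n(L^\infty(\mu))$ contains a finite frame $\{P_k\}_{k=1}^m$ such that every $\mathrm{Tr}(P_k)$ takes a constant value a.e. $[\mu]$ on $\Lambda$. Then there exists an invertible operator $X$ in $M_n(L^\infty(\mu))$ such that $XAX^{-1}$ is of the block diagonal form $XAX^{-1}=A_1\oplus\cdots\oplus A_m$, where each $A_k=(A^k_{ij})_{1\le i,j\le n_k}$ in $M_{n_k}(L^\infty(\mu))$ is upper triangular ($A^k_{ij}=0$ for $i>j$), such that: (1) $\sum_{k=1}^m n_k=n$; (2) $A^k_{jj}=A^k_{11}$ for $j=2,\dots,n_k$ and $k=1,\dots,m$; (3) the support of $A^k_{j,j+1}$ equals $\Lambda$ for $j=1,\dots,n_k-1$ and $k=1,\dots,m$.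
   Context: $\mu$ is (the completion of) a finite positive regular Borel measure supported on a compact subset $\Lambda$ of $\mathbb C$. Elements of $L^\infty(\mu)$ are regarded as multiplication operators on $L^2(\mu)$, and $M_n(L^\infty(\mu))$ acts on $(L^2(\mu))^{(n)}$; for $B\in M_n(L^\infty(\mu))$, $B(\lambda)\in M_n(\mathbb C)$ is defined for almost every $\lambda$. The relative commutant is $\{A\}'\cap M_n(L^\infty(\mu))=\{B\in M_n(L^\infty(\mu)):AB=BA\}$. "The support of $f\in L^\infty(\mu)$ equals $\Lambda$" means $f(\lambda)\neq0$ for $\mu$-almost every $\lambda\in\Lambda$. An idempotent is an operator $P$ with $P^2=P$; for an idempotent $P\in M_n(L^\infty(\mu))$, $\mathrm{Tr}(P)(\lambda)=\mathrm{Tr}(P(\lambda))=\mathrm{rank}(P(\lambda))$ a.e. Finite frame: a finite subset $\{P_k\}_{k=1}^m$ of idempotents in $\{A\}'\cap M_n(L^\infty(\mu))$ is a finite frame of $\{A\}'\cap M_n(L^\infty(\mu))$ if (i) $P_iP_j=P_jP_i=0$ for $i\ne j$; (ii) $\sum_{k=1}^m P_k$ is the identity of $M_n(L^\infty(\mu))$; (iii) for each $k$, $P_k$ is minimal (with respect to the order $P\le Q\iff PQ=QP=P$ on idempotents) in the set $\{P\in\mathscr P_k: P(\lambda)\neq 0\text{ a.e. }[\mu]\text{ on }\Lambda_k\}$, where $\mathscr P_k=\{P\in\{A\}'\cap M_n(L^\infty(\mu)):P^2=P,\ PP_k=P_kP\}$ and $\Lambda_k=\{\lambda\in\Lambda:P_k(\lambda)\ne0\}$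 is the support of $\mathrm{Tr}(P_k)$; (iv) the first three items also hold for $\{P_kE\}_{k=1}^m$ restricted to $\mathrm{ran}\,E$, for every central projection $E$ of $M_n(L^\infty(\mu))$ (i.e. $E$ is the characteristic function of a Borel subset $\Lambda_E\subseteq\Lambda$ times the identity, and one works over $\Lambda_E$). *)

theory Defs
  imports "HOL-Analysis.Analysis" "Jordan_Normal_Form.Matrix"
begin

text \<open>
  Elements of \<open>L\<^sup>\<infinity>(\<mu>)\<close> and of \<open>M\<^sub>n(L\<^sup>\<infinity>(\<mu>))\<close> are represented by functions; two
  representatives denote the same element (equivalently, the same multiplication operator) iff
  they agree almost everywhere, so every algebraic identity below is stated almost everywhere.
  All matrix and block indices start at 0.
\<close>

text \<open>
  A finite positive regular Borel measure on the plane that is supported on the compact set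
  \<open>\<Lambda>\<close>.  The underlying space is all of \<open>\<complex>\<close>; the complement of \<open>\<Lambda>\<close> is null.
\<close>

definition finite_regular_borel_on :: "complex set \<Rightarrow> complex measure \<Rightarrow> bool" where
  "finite_regular_borel_on \<Lambda> \<nu> \<longleftrightarrow>
     compact \<Lambda> \<and> sets \<nu> = sets borel \<and> finite_measure \<nu> \<and> emeasure \<nu> (- \<Lambda>) = 0 \<and>
     (\<forall>B\<in>sets \<nu>. emeasure \<nu> B = (SUP K\<in>{K. K \<subseteq> B \<and> compact K}. emeasure \<nu> K)) \<and>
     (\<forall>B\<in>sets \<nu>. emeasure \<nu> B = (INF U\<in>{U. B \<subseteq> U \<and> open U}. emeasure \<nu> U))"

definition Linf :: "complex measure \<Rightarrow> (complex \<Rightarrow> complex) set" where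
  "Linf M = {f. f \<in> borel_measurable M \<and> (\<exists>C::real. AE x in M. norm (f x) \<le> C)}"

definition Linf_mat :: "complex measure \<Rightarrow> nat \<Rightarrow> (complex \<Rightarrow> complex mat) set" where
  "Linf_mat M n = {B. (\<forall>x\<in>space M. B x \<in> carrier_mat n n) \<and>
                      (\<forall>i<n. \<forall>j<n. (\<lambda>x. B x $$ (i, j)) \<in> Linf M)}"

definition mat_trace :: "complex mat \<Rightarrow> complex" where
  "mat_trace B = (\<Sum>i<dim_row B. B $$ (i, i))"

definition rel_commutant ::
  "complex measure \<Rightarrow> nat \<Rightarrow> (complex \<Rightarrow> complex mat) \<Rightarrow> (complex \<Rightarrow> complex mat) set" where
  "rel_commutant M n A = {B \<in> Linf_mat M n. AE x in M. A x * B x = B x * A x}"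

definition idempotent_on :: "complex measure \<Rightarrow> (complex \<Rightarrow> complex mat) \<Rightarrow> bool" where
  "idempotent_on M P \<longleftrightarrow> (AE x in M. P x * P x = P x)"

definition idem_le ::
  "complex measure \<Rightarrow> (complex \<Rightarrow> complex mat) \<Rightarrow> (complex \<Rightarrow> complex mat) \<Rightarrow> bool" where
  "idem_le M P Q \<longleftrightarrow> (AE x in M. P x * Q x = P x) \<and> (AE x in M. Q x * P x = P x)"

definition minimal_in ::
  "complex measure \<Rightarrow> (complex \<Rightarrow> complex mat) set \<Rightarrow> (complex \<Rightarrow> complex mat) \<Rightarrow> bool" where
  "minimal_in M S P \<longleftrightarrow>
     P \<in> S \<and> (\<forall>Q\<in>S. idem_le M Q P \<longrightarrow> (AE x in M. Q x = P x))"

text \<open>The set \<open>\<P>\<^sub>k\<close> of the idempotents in the relative commutant that commute with \<open>P\<^sub>k = R\<close>.\<close>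

definition commuting_idempotents ::
  "complex measure \<Rightarrow> nat \<Rightarrow> (complex \<Rightarrow> complex mat) \<Rightarrow> (complex \<Rightarrow> complex mat) \<Rightarrow>
     (complex \<Rightarrow> complex mat) set" where
  "commuting_idempotents M n A R =
     {P \<in> rel_commutant M n A. idempotent_on M P \<and> (AE x in M. P x * R x = R x * P x)}"

definition mat_support :: "complex measure \<Rightarrow> nat \<Rightarrow> (complex \<Rightarrow> complex mat) \<Rightarrow> complex set" where
  "mat_support M n P = {x \<in> space M. P x \<noteq> 0\<^sub>m n n}"

text \<open>
  Items (i)--(iii) of the definition of a finite frame, over an arbitrary measure \<open>M\<close> so that they
  can be localised.  The sum is written entrywise since matrices of varying size do not form an
  additive monoid type.
\<close>

definition frame_items ::
  "complex measure \<Rightarrow> nat \<Rightarrow> (complex \<Rightarrow> complex mat) \<Rightarrow> nat \<Rightarrow>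
     (nat \<Rightarrow> complex \<Rightarrow> complex mat) \<Rightarrow> bool" where
  "frame_items M n A m P \<longleftrightarrow>
     (\<forall>i<m. \<forall>j<m. i \<noteq> j \<longrightarrow>
        (AE x in M. P i x * P j x = 0\<^sub>m n n \<and> P j x * P i x = 0\<^sub>m n n)) \<and>
     (AE x in M. mat n n (\<lambda>(i, j). \<Sum>k<m. P k x $$ (i, j)) = 1\<^sub>m n) \<and>
     (\<forall>k<m. minimal_in M
        {Q \<in> commuting_idempotents M n A (P k).
           AE x in M. x \<in> mat_support M n (P k) \<longrightarrow> Q x \<noteq> 0\<^sub>m n n}
        (P k))"

text \<open>
  A finite frame \<open>P\<^sub>0, \<dots>, P\<^bsub>m-1\<^esub>\<close> of the relative commutant of \<open>A\<close>.  The central projection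
  given by a Borel set \<open>E \<subseteq> \<Lambda>\<close> has range \<open>L\<^sup>2(\<mu>|E)\<^sup>n\<close>; restricting to this range
  the matrices \<open>P\<^sub>k E\<close> and \<open>A E\<close> become \<open>P\<^sub>k\<close> and \<open>A\<close> viewed over \<open>\<mu>|E\<close>.
\<close>

definition finite_frame ::
  "complex set \<Rightarrow> complex measure \<Rightarrow> nat \<Rightarrow> (complex \<Rightarrow> complex mat) \<Rightarrow> nat \<Rightarrow>
     (nat \<Rightarrow> complex \<Rightarrow> complex mat) \<Rightarrow> bool" where
  "finite_frame \<Lambda> \<mu> n A m P \<longleftrightarrow>
     1 \<le> m \<and>
     (\<forall>k<m. P k \<in> rel_commutant \<mu> n A \<and> idempotent_on \<mu> (P k)) \<and>
     frame_items \<mu> n A m P \<and>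
     (\<forall>E\<in>sets borel. E \<subseteq> \<Lambda> \<longrightarrow> frame_items (restrict_space \<mu> E) n A m P)"

text \<open>\<open>Y\<close> is the inverse of \<open>X\<close> in \<open>M\<^sub>n(L\<^sup>\<infinity>(\<mu>))\<close>.\<close>

definition Linf_inverse ::
  "complex measure \<Rightarrow> nat \<Rightarrow> (complex \<Rightarrow> complex mat) \<Rightarrow> (complex \<Rightarrow> complex mat) \<Rightarrow> bool" where
  "Linf_inverse M n X Y \<longleftrightarrow>
     X \<in> Linf_mat M n \<and> Y \<in> Linf_mat M n \<and>
     (AE x in M. inverts_mat (X x) (Y x) \<and> inverts_mat (Y x) (X x))"

end

theory Submission
  imports Defs "Jordan_Normal_Form.Jordan_Normal_Form_Existence"
begin

text \<open>
  Over a point \<open>x\<close>, an idempotent \<open>P\<^sub>k(x)\<close> commuting with \<open>A(x)\<close> has an orthonormal basis of its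
  range that makes the compression of \<open>A(x)\<close> upper triangular; orthonormality bounds the basis and
  the dual coordinates uniformly in \<open>x\<close>, so the admissible pairs of coordinate matrices are the zeros,
  in a fixed compact set, of a function measurable in \<open>x\<close> and continuous in the matrices.  Such zeros
  can be selected measurably, which yields the blocks.  The same selection principle, applied over the
  set of those \<open>x\<close> for which some nontrivial idempotent below \<open>P\<^sub>k(x)\<close> commutes with \<open>A(x)\<close>, together
  with the local minimality of \<open>P\<^sub>k\<close>, shows that this set is null.  At all other points
  the compression of \<open>A(x)\<close> is therefore a single Jordan block up to similarity, and
  an upper triangular matrix similar to a Jordan block has constant diagonal and nowhere vanishing
  superdiagonal.
\<close>

subsection \<open>Measurable selection of zeros\<close>

text \<open>Selection needs compactness, but the nontrivial idempotents below \<open>P k x\<close>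
  that commute with \<open>A x\<close> may form an unbounded set, since oblique idempotents can have
  arbitrarily large norm. The bad points are therefore exhausted by countably many classes: entries
  bounded by \<open>c\<close>, and distance at least \<open>1 / Suc c\<close> from both 0 and
  \<open>P k x\<close>.

  Constancy of the traces makes the size of the coordinate matrices independent of the point,
  because the trace of an idempotent is its rank. One compact set of pairs then serves almost every
  point.

  Jordan bases admit no uniform bound, as a small superdiagonal entry already shows. Hence only a
  triangular basis is selected, and the Jordan form is used at single points, merely to read off the
  entries: for a single block of size \<open>r\<close> with eigenvalue \<open>a\<close>, the corner
  entry of the power \<open>r - 1\<close> of \<open>T - a\<close> is the product of the
  superdiagonal entries of \<open>T\<close>, and it cannot vanish because the nilpotent Jordan block
  of size \<open>r\<close> has nonzero power \<open>r - 1\<close>.\<close>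

lemma compact_zero_iff_small_on_dense:
  fixes f :: "'k::topological_space \<Rightarrow> real"
  assumes K: "compact K" and D: "D \<subseteq> K" "K \<subseteq> closure D"
    and cont: "continuous_on K f" and nonneg: "\<And>k. k \<in> K \<Longrightarrow> 0 \<le> f k"
  shows "(\<exists>k\<in>K. f k = 0) \<longleftrightarrow> (\<forall>n::nat. \<exists>d\<in>D. f d < 1 / Suc n)"
proof
  assume "\<exists>k\<in>K. f k = 0"
  then obtain k where k: "k \<in> K" "f k = 0" by blast
  show "\<forall>n::nat. \<exists>d\<in>D. f d < 1 / Suc n"
  proof
    fix n :: nat
    obtain U where U: "open U" "U \<inter> K = f -` {..< 1 / Suc n} \<inter> K"
      using cont unfolding continuous_on_open_invariant by (meson open_lessThan)
    have "k \<in> U" using U k by auto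
    then have "U \<inter> D \<noteq> {}"
      using open_Int_closure_eq_empty[OF U(1), of D] D(2) k(1) by auto
    then show "\<exists>d\<in>D. f d < 1 / Suc n" using U(2) D(1) by auto
  qed
next
  assume small: "\<forall>n::nat. \<exists>d\<in>D. f d < 1 / Suc n"
  then have "K \<noteq> {}" using D(1) by blast
  then obtain k where k: "k \<in> K" "\<And>d. d \<in> K \<Longrightarrow> f k \<le> f d"
    using continuous_attains_inf[OF K _ cont] by blast
  \<comment> \<open>The minimum over \<open>K\<close> is attained at \<open>k\<close>; if it were
    positive, it would bound \<open>f\<close> away from 0 on \<open>D\<close> as well.\<close>
  have "\<not> 0 < f k"
  proof
    assume "0 < f k"
    then obtain n where "1 / Suc n < f k" using nat_approx_posE by metis
    moreover obtain d where "d \<in> D" "f d < 1 / Suc n" using small by blast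
    moreover have "f k \<le> f d" using k(2) D(1) \<open>d \<in> D\<close> by blast
    ultimately show False by simp
  qed
  then show "\<exists>k\<in>K. f k = 0" using k(1) nonneg[OF k(1)] by force
qed

text \<open>An existential over an uncountable \<open>K\<close> does not preserve measurability by
  itself. By compactness a zero exists iff \<open>f x\<close> gets below every
  \<open>1 / Suc n\<close> on a countable dense \<open>D\<close>, which leaves countable unions and
  intersections.\<close>

lemma measurable_exists_zero:
  fixes f :: "'a \<Rightarrow> 'k::{metric_space, second_countable_topology} \<Rightarrow> real"
  assumes K: "compact K"
    and meas: "\<And>k. k \<in> K \<Longrightarrow> (\<lambda>x. f x k) \<in> borel_measurable M"
    and cont: "\<And>x. x \<in> space M \<Longrightarrow> continuous_on K (f x)"
    and nonneg: "\<And>x k. x \<in> space M \<Longrightarrow> k \<in> K \<Longrightarrow> 0 \<le> f x k"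
  shows "{x \<in> space M. \<exists>k\<in>K. f x k = 0} \<in> sets M"
proof -
  obtain D where D: "countable D" "D \<subseteq> K" "K \<subseteq> closure D" using separable by blast
  have "{x \<in> space M. \<exists>k\<in>K. f x k = 0}
      = {x \<in> space M. \<forall>n::nat. \<exists>d\<in>D. f x d < 1 / Suc n}"
    using compact_zero_iff_small_on_dense[OF K D(2,3) cont nonneg] by blast
  also have "\<dots> = (\<Inter>n::nat. \<Union>d\<in>D. {x \<in> space M. f x d < 1 / Suc n}) \<inter> space M"
    by auto
  also have "\<dots> \<in> sets M"
  proof -
    have "{x \<in> space M. f x d < 1 / Suc n} \<in> sets M" if "d \<in> D" for d n
      using meas[of d] D(2) that by (intro borel_measurable_less borel_measurable_const) auto
    then have "(\<Union>d\<in>D. {x \<in> space M. f x d < 1 / Suc n}) \<in> sets M" for n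
      by (intro sets.countable_UN' D(1)) auto
    then show ?thesis by (intro sets.Int sets.countable_INT) auto
  qed
  finally show ?thesis .
qed

text \<open>\<open>t x\<close> is the minimum of \<phi> over the zeros of \<open>f x\<close>. It is
  at most \<open>a\<close> iff \<open>f x\<close> has a zero in the compact sublevel set of \<phi>,
  so \<open>measurable_exists_zero\<close> applies to that smaller set. The minimiser itself is not
  claimed to depend measurably on \<open>x\<close>.\<close>

lemma measurable_least_coordinate_of_zero:
  fixes f :: "'a \<Rightarrow> 'k::{metric_space, second_countable_topology} \<Rightarrow> real"
  assumes K: "compact K"
    and meas: "\<And>k. k \<in> K \<Longrightarrow> (\<lambda>x. f x k) \<in> borel_measurable M"
    and cont: "\<And>x. x \<in> space M \<Longrightarrow> continuous_on K (f x)"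
    and nonneg: "\<And>x k. x \<in> space M \<Longrightarrow> k \<in> K \<Longrightarrow> 0 \<le> f x k"
    and zero: "\<And>x. x \<in> space M \<Longrightarrow> \<exists>k\<in>K. f x k = 0"
    and \<phi>: "continuous_on K \<phi>"
  obtains t :: "'a \<Rightarrow> real" where "t \<in> borel_measurable M"
    "\<And>x. x \<in> space M \<Longrightarrow> \<exists>k\<in>K. f x k = 0 \<and> \<phi> k = t x"
proof -
  have "\<exists>k. k \<in> K \<and> f x k = 0 \<and> (\<forall>l\<in>K. f x l = 0 \<longrightarrow> \<phi> k \<le> \<phi> l)" if x: "x \<in> space M" for x
  proof -
    have "closedin (top_of_set K) {k \<in> K. f x k = 0}"
      using continuous_closedin_preimage_constant[OF cont[OF x]] .
    then have "compact {k \<in> K. f x k = 0}" using K closedin_compact by blast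
    moreover have "{k \<in> K. f x k = 0} \<noteq> {}" using zero[OF x] by blast
    moreover have "continuous_on {k \<in> K. f x k = 0} \<phi>"
      using \<phi> by (rule continuous_on_subset) auto
    ultimately show ?thesis
      using continuous_attains_inf[of "{k \<in> K. f x k = 0}" \<phi>] by blast
  qed
  then obtain k where k: "\<And>x. x \<in> space M \<Longrightarrow>
      k x \<in> K \<and> f x (k x) = 0 \<and> (\<forall>l\<in>K. f x l = 0 \<longrightarrow> \<phi> (k x) \<le> \<phi> l)"
    by metis
  have "(\<lambda>x. \<phi> (k x)) \<in> borel_measurable M"
    unfolding borel_measurable_iff_le
  proof
    fix a :: real
    let ?K = "{l \<in> K. \<phi> l \<le> a}"
    have "closedin (top_of_set K) (K \<inter> \<phi> -` {..a})"
      using continuous_closedin_preimage[OF \<phi>, of "{..a}"] by simp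
    then have "compact (K \<inter> \<phi> -` {..a})" using K closedin_compact by blast
    moreover have "?K = K \<inter> \<phi> -` {..a}" by auto
    ultimately have "compact ?K" by simp
    then have "{x \<in> space M. \<exists>l\<in>?K. f x l = 0} \<in> sets M"
      using meas continuous_on_subset[OF cont] nonneg by (intro measurable_exists_zero) auto
    moreover have "{x \<in> space M. \<phi> (k x) \<le> a} = {x \<in> space M. \<exists>l\<in>?K. f x l = 0}"
      using k by fastforce
    ultimately show "{x \<in> space M. \<phi> (k x) \<le> a} \<in> sets M" by simp
  qed
  then show thesis using k that[of "\<lambda>x. \<phi> (k x)"] by blast
qed

text \<open>
  The selected zero is the lexicographic minimum: each coordinate in turn is minimised over the zeros
  that remain, and adding \<open>\<bar>\<phi> k - u x\<bar>\<close> to \<open>f x k\<close> fixes the value found.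
\<close>

lemma measurable_coordinates_of_zero:
  fixes f :: "'a \<Rightarrow> 'k::{metric_space, second_countable_topology} \<Rightarrow> real"
  assumes "finite \<Phi>" and K: "compact K"
    and "\<And>k. k \<in> K \<Longrightarrow> (\<lambda>x. f x k) \<in> borel_measurable M"
    and "\<And>x. x \<in> space M \<Longrightarrow> continuous_on K (f x)"
    and "\<And>x k. x \<in> space M \<Longrightarrow> k \<in> K \<Longrightarrow> 0 \<le> f x k"
    and "\<And>x. x \<in> space M \<Longrightarrow> \<exists>k\<in>K. f x k = 0"
    and "\<And>\<phi>. \<phi> \<in> \<Phi> \<Longrightarrow> continuous_on K \<phi>"
  shows "\<exists>t :: ('k \<Rightarrow> real) \<Rightarrow> 'a \<Rightarrow> real. (\<forall>\<phi>\<in>\<Phi>. t \<phi> \<in> borel_measurable M) \<and>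
    (\<forall>x\<in>space M. \<exists>k\<in>K. f x k = 0 \<and> (\<forall>\<phi>\<in>\<Phi>. \<phi> k = t \<phi> x))"
  using assms(1,3-)
proof (induction \<Phi> arbitrary: f rule: finite_induct)
  case empty
  then show ?case by auto
next
  case (insert \<phi> \<Phi> f)
  obtain u where u: "u \<in> borel_measurable M"
    "\<And>x. x \<in> space M \<Longrightarrow> \<exists>k\<in>K. f x k = 0 \<and> \<phi> k = u x"
    using measurable_least_coordinate_of_zero[OF K insert.prems(1-4) insert.prems(5)[of \<phi>]] by auto
  define g where "g x k = f x k + \<bar>\<phi> k - u x\<bar>" for x k
  have "\<exists>t. (\<forall>\<phi>\<in>\<Phi>. t \<phi> \<in> borel_measurable M) \<and>
    (\<forall>x\<in>space M. \<exists>k\<in>K. g x k = 0 \<and> (\<forall>\<phi>\<in>\<Phi>. \<phi> k = t \<phi> x))"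
  proof (rule insert.IH)
    show "(\<lambda>x. g x k) \<in> borel_measurable M" if "k \<in> K" for k
      using insert.prems(1)[OF that] u(1) unfolding g_def by measurable
    show "continuous_on K (g x)" if "x \<in> space M" for x
      using insert.prems(2)[OF that] insert.prems(5)[of \<phi>] unfolding g_def
      by (intro continuous_intros) auto
    show "0 \<le> g x k" if "x \<in> space M" "k \<in> K" for x k
      using insert.prems(3)[OF that] by (simp add: g_def)
    show "\<exists>k\<in>K. g x k = 0" if "x \<in> space M" for x
      using u(2)[OF that] by (force simp: g_def)
    show "continuous_on K \<psi>" if "\<psi> \<in> \<Phi>" for \<psi> using insert.prems(5) that by simp
  qed
  then obtain t where t: "\<forall>\<psi>\<in>\<Phi>. t \<psi> \<in> borel_measurable M"
    "\<forall>x\<in>space M. \<exists>k\<in>K. g x k = 0 \<and> (\<forall>\<psi>\<in>\<Phi>. \<psi> k = t \<psi> x)"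
    by (elim exE conjE) (rule that)
  have "\<exists>k\<in>K. f x k = 0 \<and> (\<forall>\<psi>\<in>insert \<phi> \<Phi>. \<psi> k = (t(\<phi> := u)) \<psi> x)" if x: "x \<in> space M" for x
  proof -
    obtain k where k: "k \<in> K" "g x k = 0" "\<forall>\<psi>\<in>\<Phi>. \<psi> k = t \<psi> x" using bspec[OF t(2) x] by blast
    then have "f x k = 0 \<and> \<phi> k = u x"
      using insert.prems(3)[OF x k(1)] by (auto simp: g_def)
    then show ?thesis using k by auto
  qed
  moreover have "\<forall>\<psi>\<in>insert \<phi> \<Phi>. (t(\<phi> := u)) \<psi> \<in> borel_measurable M" using t(1) u(1) by auto
  ultimately show ?case by (intro exI[of _ "t(\<phi> := u)"] conjI) (assumption | rule ballI, blast)+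
qed

text \<open>Tychonoff. Unknown matrices are encoded as functions on a countable index type, because
  these form a second countable metric space as the selection lemmas demand.\<close>

lemma compact_polydisc: "compact {g :: 'i \<Rightarrow> complex. \<forall>i. norm (g i) \<le> C}"
proof -
  have "compactin (product_topology (\<lambda>_::'i. euclidean) UNIV) (PiE UNIV (\<lambda>_. cball (0::complex) C))"
    by (simp add: compactin_PiE)
  moreover have "PiE UNIV (\<lambda>_. cball (0::complex) C) = {g :: 'i \<Rightarrow> complex. \<forall>i. norm (g i) \<le> C}"
    by (auto simp: PiE_def Pi_def)
  ultimately show ?thesis by (simp add: euclidean_product_topology)
qed

text \<open>The sum of the norms turns a finite system of equations into one nonnegative function
  with the same zeros.\<close>

lemma measurable_exists_common_zero:
  fixes F :: "'c \<Rightarrow> 'a \<Rightarrow> ('i::countable \<Rightarrow> complex) \<Rightarrow> complex"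
  assumes "finite S"
    and meas: "\<And>c g. c \<in> S \<Longrightarrow> (\<lambda>x. F c x g) \<in> borel_measurable M"
    and cont: "\<And>c x. c \<in> S \<Longrightarrow> x \<in> space M \<Longrightarrow> continuous_on UNIV (F c x)"
  shows "{x \<in> space M. \<exists>g. (\<forall>i. norm (g i) \<le> C) \<and> (\<forall>c\<in>S. F c x g = 0)} \<in> sets M"
proof -
  let ?f = "\<lambda>x g. \<Sum>c\<in>S. norm (F c x g)"
  let ?K = "{g :: 'i \<Rightarrow> complex. \<forall>i. norm (g i) \<le> C}"
  have "{x \<in> space M. \<exists>g\<in>?K. ?f x g = 0} \<in> sets M"
  proof (rule measurable_exists_zero[OF compact_polydisc])
    show "(\<lambda>x. ?f x k) \<in> borel_measurable M" for k using meas by measurable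
    show "continuous_on ?K (?f x)" if "x \<in> space M" for x
      using continuous_on_subset[OF cont[OF _ that]] by (intro continuous_intros) auto
  qed (simp add: sum_nonneg)
  then show ?thesis using \<open>finite S\<close> by (simp add: sum_nonneg_eq_0_iff)
qed

text \<open>Only the finitely many coordinates in \<open>I\<close> are selected, so
  \<open>s x\<close> itself need not solve the system. It agrees on \<open>I\<close> with a bounded
  solution \<open>g\<close>, which is enough when the equations involve those coordinates
  alone.\<close>

lemma measurable_common_zero_selection:
  fixes F :: "'c \<Rightarrow> 'a \<Rightarrow> ('i::countable \<Rightarrow> complex) \<Rightarrow> complex"
  assumes S: "finite S" and I: "finite I" and C: "0 \<le> C"
    and meas: "\<And>c g. c \<in> S \<Longrightarrow> (\<lambda>x. F c x g) \<in> borel_measurable M"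
    and cont: "\<And>c x. c \<in> S \<Longrightarrow> x \<in> space M \<Longrightarrow> continuous_on UNIV (F c x)"
    and zero: "AE x in M. \<exists>g. (\<forall>i. norm (g i) \<le> C) \<and> (\<forall>c\<in>S. F c x g = 0)"
  obtains s :: "'a \<Rightarrow> 'i \<Rightarrow> complex" where
    "\<And>i. (\<lambda>x. s x i) \<in> borel_measurable M"
    "AE x in M. \<exists>g. (\<forall>i. norm (g i) \<le> C) \<and> (\<forall>c\<in>S. F c x g = 0) \<and> (\<forall>i\<in>I. g i = s x i)"
proof -
  obtain N where N: "N \<in> null_sets M"
    "{x \<in> space M. \<not> (\<exists>g. (\<forall>i. norm (g i) \<le> C) \<and> (\<forall>c\<in>S. F c x g = 0))} \<subseteq> N"
    using zero unfolding eventually_ae_filter by blast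
  \<comment> \<open>The selection lemma demands a zero at every point. On the null set
    \<open>N\<close>, which contains the exceptional points, every \<open>g\<close> is therefore
    declared a zero.\<close>
  define f where "f x g = (if x \<in> N then 0 else \<Sum>c\<in>S. norm (F c x g))" for x g
  let ?K = "{g :: 'i \<Rightarrow> complex. \<forall>i. norm (g i) \<le> C}"
  \<comment> \<open>Coordinates are minimised, so they must be real: real and imaginary parts are
    treated separately.\<close>
  let ?\<Phi> = "(\<lambda>i g. Re (g i)) ` I \<union> (\<lambda>i g. Im (g i)) ` I"
  have f0: "f x g = 0 \<longleftrightarrow> x \<in> N \<or> (\<forall>c\<in>S. F c x g = 0)" for x g
    using S by (simp add: f_def sum_nonneg_eq_0_iff)
  have "\<exists>t. (\<forall>\<phi>\<in>?\<Phi>. t \<phi> \<in> borel_measurable M) \<and>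
    (\<forall>x\<in>space M. \<exists>g\<in>?K. f x g = 0 \<and> (\<forall>\<phi>\<in>?\<Phi>. \<phi> g = t \<phi> x))"
  proof (rule measurable_coordinates_of_zero[OF _ compact_polydisc])
    show "finite ?\<Phi>" using I by simp
    show "(\<lambda>x. f x g) \<in> borel_measurable M" for g
      unfolding f_def using meas null_setsD2[OF N(1)] by measurable
    show "continuous_on ?K (f x)" if "x \<in> space M" for x
      unfolding f_def using continuous_on_subset[OF cont[OF _ that]]
      by (cases "x \<in> N") (auto intro!: continuous_intros)
    show "0 \<le> f x g" for x g by (simp add: f_def sum_nonneg)
    show "\<exists>g\<in>?K. f x g = 0" if "x \<in> space M" for x
    proof (cases "x \<in> N")
      case True
      then show ?thesis using C by (intro bexI[of _ "\<lambda>_. 0"]) (auto simp: f0)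
    next
      case False
      then have "\<exists>g. (\<forall>i. norm (g i) \<le> C) \<and> (\<forall>c\<in>S. F c x g = 0)" using N(2) that by blast
      then show ?thesis by (auto simp: f0)
    qed
    show "continuous_on ?K \<phi>" if "\<phi> \<in> ?\<Phi>" for \<phi>
      using that continuous_on_subset[OF continuous_on_product_coordinates]
      by (auto intro!: continuous_intros)
  qed
  then obtain t where t: "\<forall>\<phi>\<in>?\<Phi>. t \<phi> \<in> borel_measurable M"
    "\<forall>x\<in>space M. \<exists>g\<in>?K. f x g = 0 \<and> (\<forall>\<phi>\<in>?\<Phi>. \<phi> g = t \<phi> x)"
    by (elim exE conjE) (rule that)
  define s where "s x i = (if i \<in> I then
      Complex (t (\<lambda>g. Re (g i)) x) (t (\<lambda>g. Im (g i)) x) else 0)" for x i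
  show thesis
  proof (rule that[of s])
    show "(\<lambda>x. s x i) \<in> borel_measurable M" for i
    proof (cases "i \<in> I")
      case True
      then have "t (\<lambda>g. Re (g i)) \<in> borel_measurable M" "t (\<lambda>g. Im (g i)) \<in> borel_measurable M"
        using t(1) by auto
      then show ?thesis using True by (simp add: s_def Complex_eq)
    qed (simp add: s_def)
    have "AE x in M. x \<notin> N" using N(1) AE_not_in by blast
    then show "AE x in M. \<exists>g. (\<forall>i. norm (g i) \<le> C) \<and> (\<forall>c\<in>S. F c x g = 0) \<and> (\<forall>i\<in>I. g i = s x i)"
      using AE_space
    proof eventually_elim
      case (elim x)
      then obtain g where g: "g \<in> ?K" "f x g = 0" "\<forall>\<phi>\<in>?\<Phi>. \<phi> g = t \<phi> x"
        using bspec[OF t(2) elim(2)] by blast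
      have "g i = s x i" if "i \<in> I" for i
      proof -
        have "(\<lambda>g. Re (g i)) \<in> ?\<Phi>" "(\<lambda>g. Im (g i)) \<in> ?\<Phi>" using that by blast+
        then have "Re (g i) = t (\<lambda>g. Re (g i)) x" "Im (g i) = t (\<lambda>g. Im (g i)) x"
          using g(3)[rule_format, of "\<lambda>g. Re (g i)"] g(3)[rule_format, of "\<lambda>g. Im (g i)"] by simp_all
        then show ?thesis using that by (simp add: s_def complex_eq_iff)
      qed
      then show ?case using g(1,2) elim(1) f0[of x g] by blast
    qed
  qed
qed

subsection \<open>Linear algebra at a point\<close>

text \<open>An entry of the power is a sum over chains of \<open>k\<close> index steps, and every
  nonzero factor raises the index by at least one. So \<open>i + k\<close> is the first column that
  can be reached, and only by unit steps along the superdiagonal.\<close>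

lemma strictly_upper_triangular_pow:
  fixes N :: "'a::comm_semiring_1 mat"
  assumes N: "N \<in> carrier_mat r r"
    and su: "\<And>i j. i < r \<Longrightarrow> j \<le> i \<Longrightarrow> N $$ (i, j) = 0"
    and ij: "i < r" "j < r" "j \<le> i + k"
  shows "(N ^\<^sub>m k) $$ (i, j) = (if j = i + k then \<Prod>l<k. N $$ (i + l, Suc (i + l)) else 0)"
  using ij(2-)
proof (induction k arbitrary: j)
  case 0
  then show ?case using ij(1) N by auto
next
  case (Suc k)
  have Nk: "N ^\<^sub>m k \<in> carrier_mat r r" using N by simp
  have "(N ^\<^sub>m Suc k) $$ (i, j) = (\<Sum>l<r. (N ^\<^sub>m k) $$ (i, l) * N $$ (l, j))"
    using N Nk ij(1) Suc.prems(1) by (simp add: scalar_prod_def atLeast0LessThan)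
  also have "\<dots> = (\<Sum>l<r. if l = i + k then (if j = Suc (i + k)
      then (\<Prod>l<k. N $$ (i + l, Suc (i + l))) * N $$ (i + k, j) else 0) else 0)"
  proof (rule sum.cong)
    fix l assume "l \<in> {..<r}"
    then have l: "l < r" by simp
    show "(N ^\<^sub>m k) $$ (i, l) * N $$ (l, j) = (if l = i + k then (if j = Suc (i + k)
      then (\<Prod>l<k. N $$ (i + l, Suc (i + l))) * N $$ (i + k, j) else 0) else 0)"
    proof (cases "l \<le> i + k")
      case True
      then show ?thesis using Suc.IH[OF l True] su[OF l, of j] Suc.prems(2) by auto
    next
      case False
      then show ?thesis using su[OF l, of j] Suc.prems by auto
    qed
  qed simp
  also have "\<dots> = (if j = i + Suc k then \<Prod>l<Suc k. N $$ (i + l, Suc (i + l)) else 0)"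
    using Suc.prems(1) by (auto simp: sum.delta)
  finally show ?case .
qed

text \<open>The Schur form has only zeros on its diagonal, so it is strictly upper triangular, and
  in its \<open>n\<close>-th power no column \<open>j < n\<close> reaches
  \<open>i + n\<close>.\<close>

lemma nilpotent_if_no_nonzero_eigenvalue:
  fixes M :: "complex mat"
  assumes M: "M \<in> carrier_mat n n" and ev: "\<And>c. eigenvalue M c \<Longrightarrow> c = 0"
  shows "M ^\<^sub>m n = 0\<^sub>m n n"
proof -
  obtain es where es: "char_poly M = (\<Prod>e\<leftarrow>es. [:- e, 1:])"
    using char_poly_factorized[OF M] by auto
  have zero: "e = 0" if "e \<in> set es" for e
    using that by (intro ev) (auto simp: eigenvalue_root_char_poly[OF M] es poly_prod_list prod_list_zero_iff)
  obtain B S S' where B: "schur_decomposition M es = (B, S, S')" by (cases "schur_decomposition M es")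
  note schur = schur_decomposition[OF M es B]
  then have sim: "similar_mat_wit M B S S'" and ut: "upper_triangular B" and diag: "diag_mat B = es"
    by auto
  note w = similar_mat_witD2[OF M sim]
  have "B $$ (i, j) = 0" if "i < n" "j \<le> i" for i j
  proof (cases "j = i")
    case True
    then have "B $$ (i, j) \<in> set es" using diag w(5) that(1) by (auto simp: diag_mat_def)
    then show ?thesis by (rule zero)
  next
    case False
    then show ?thesis using upper_triangularD[OF ut, of j i] that w(5) by auto
  qed
  then have "B ^\<^sub>m n = 0\<^sub>m n n"
    using w(5) by (intro eq_matI) (auto simp: strictly_upper_triangular_pow[OF w(5)])
  then show ?thesis using similar_mat_wit_pow_id[OF sim, of n] w by simp
qed

lemma pow_mat_Suc_left:
  assumes M: "M \<in> carrier_mat n n"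
  shows "M ^\<^sub>m Suc j = M * M ^\<^sub>m j"
proof (induction j)
  case 0
  show ?case using M by simp
next
  case (Suc j)
  have "M ^\<^sub>m Suc (Suc j) = (M * M ^\<^sub>m j) * M" using Suc by simp
  also have "\<dots> = M * (M ^\<^sub>m j * M)" by (rule assoc_mult_mat[OF M pow_carrier_mat[OF M] M])
  finally show ?case by simp
qed

text \<open>
  An eigenvector of \<open>A * P\<close> with nonzero eigenvalue lies in the range of \<open>P\<close>.  If there is none,
  \<open>A * P\<close> is nilpotent and the columns of the last nonzero \<open>(A * P)\<^sup>j * P\<close> are killed by \<open>A\<close>.
\<close>

lemma eigenvector_in_invariant_range:
  fixes A P :: "complex mat"
  assumes A: "A \<in> carrier_mat n n" and P: "P \<in> carrier_mat n n"
    and idem: "P * P = P" and inv: "P * (A * P) = A * P" and nz: "P \<noteq> 0\<^sub>m n n"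
  obtains v c where "v \<in> carrier_vec n" "v \<noteq> 0\<^sub>v n" "P *\<^sub>v v = v" "A *\<^sub>v v = c \<cdot>\<^sub>v v"
proof (cases "\<exists>c. eigenvalue (A * P) c \<and> c \<noteq> 0")
  case True
  then obtain c v where c: "c \<noteq> 0" and v: "v \<in> carrier_vec n" "v \<noteq> 0\<^sub>v n" "(A * P) *\<^sub>v v = c \<cdot>\<^sub>v v"
    using A unfolding eigenvalue_def eigenvector_def by auto
  have "c \<cdot>\<^sub>v (P *\<^sub>v v) = P *\<^sub>v ((A * P) *\<^sub>v v)" using v P by (simp add: mult_mat_vec)
  also have "\<dots> = (P * (A * P)) *\<^sub>v v" using A P v(1) by (metis assoc_mult_mat_vec mult_carrier_mat)
  also have "\<dots> = c \<cdot>\<^sub>v v" unfolding inv using v by simp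
  finally have "c \<cdot>\<^sub>v (P *\<^sub>v v) = c \<cdot>\<^sub>v v" .
  then have "(1/c) \<cdot>\<^sub>v (c \<cdot>\<^sub>v (P *\<^sub>v v)) = (1/c) \<cdot>\<^sub>v (c \<cdot>\<^sub>v v)" by simp
  then have Pv: "P *\<^sub>v v = v" using c by (simp add: smult_smult_assoc)
  then have "A *\<^sub>v v = c \<cdot>\<^sub>v v" using v A P by simp
  then show ?thesis using that v Pv by blast
next
  case False
  define B where "B j = (A * P) ^\<^sub>m j * P" for j
  have AP: "A * P \<in> carrier_mat n n" using A P by simp
  have Bc: "B j \<in> carrier_mat n n" for j
    unfolding B_def by (rule mult_carrier_mat[OF pow_carrier_mat[OF AP] P])
  have "(A * P) ^\<^sub>m n = 0\<^sub>m n n" using False by (intro nilpotent_if_no_nonzero_eigenvalue AP) auto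
  then have Bn: "B n = 0\<^sub>m n n" using P by (simp add: B_def)
  have B0: "B 0 = P" using A P by (simp add: B_def)
  \<comment> \<open>The sequence starts at the nonzero \<open>P\<close> and has reached 0 at index
    \<open>n\<close>.\<close>
  have "\<exists>j. B j \<noteq> 0\<^sub>m n n \<and> B (Suc j) = 0\<^sub>m n n"
  proof (rule ccontr)
    assume "\<not> ?thesis"
    then have "B j \<noteq> 0\<^sub>m n n" for j by (induction j) (use nz B0 in auto)
    then show False using Bn by blast
  qed
  then obtain j where j: "B j \<noteq> 0\<^sub>m n n" "B (Suc j) = 0\<^sub>m n n" by blast
  have Bs: "B (Suc j) = (A * P) * B j" for j
  proof -
    have pow: "(A * P) ^\<^sub>m j \<in> carrier_mat n n" by (rule pow_carrier_mat[OF AP])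
    have "(A * P) ^\<^sub>m Suc j = (A * P) * (A * P) ^\<^sub>m j" by (rule pow_mat_Suc_left[OF AP])
    then show ?thesis unfolding B_def using assoc_mult_mat[OF AP pow P] by simp
  qed
  have PB: "P * B j = B j" for j
  proof (induction j)
    case 0
    show ?case using idem B0 by simp
  next
    case (Suc j)
    have "P * B (Suc j) = (P * (A * P)) * B j"
      unfolding Bs using P AP Bc[of j] by (metis assoc_mult_mat)
    then show ?case unfolding inv Bs .
  qed
  obtain a b where ab: "a < n" "b < n" "B j $$ (a, b) \<noteq> 0"
    using j(1) Bc[of j] by (metis eq_matI carrier_matD index_zero_mat)
  define v where "v = col (B j) b"
  have v: "v \<in> carrier_vec n" using Bc[of j] by (auto simp: v_def)
  have "v $ a \<noteq> 0" using ab Bc[of j] by (simp add: v_def)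
  then have "v \<noteq> 0\<^sub>v n" using ab by auto
  moreover have Pv: "P *\<^sub>v v = v"
    using PB[of j] col_mult2[OF P Bc[of j] ab(2)] by (simp add: v_def)
  moreover have "A *\<^sub>v v = 0 \<cdot>\<^sub>v v"
  proof -
    have "A *\<^sub>v v = (A * P) *\<^sub>v v" using A P v Pv by simp
    also have "\<dots> = col (B (Suc j)) b" using col_mult2[OF AP Bc[of j] ab(2)] by (simp add: v_def Bs)
    also have "\<dots> = 0 \<cdot>\<^sub>v v" unfolding j(2) using v ab by auto
    finally show ?thesis .
  qed
  ultimately show ?thesis using that v by blast
qed

text \<open>Two or more Jordan blocks would give a nontrivial idempotent commuting with
  \<open>T\<close>, so there is one block, with eigenvalue \<open>a\<close>. The characteristic
  polynomial then makes the diagonal constant, and a zero on the superdiagonal would make the power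
  \<open>r - 1\<close> of \<open>T - a\<close> vanish, which similarity to a single block
  excludes.\<close>

lemma indecomposable_upper_triangular:
  fixes T :: "complex mat"
  assumes T: "T \<in> carrier_mat r r" and ut: "upper_triangular T"
    and indec: "\<And>Q. Q \<in> carrier_mat r r \<Longrightarrow> Q * Q = Q \<Longrightarrow> T * Q = Q * T \<Longrightarrow>
      Q = 0\<^sub>m r r \<or> Q = 1\<^sub>m r"
  shows "\<And>j. j < r \<Longrightarrow> T $$ (j, j) = T $$ (0, 0)"
    and "\<And>j. Suc j < r \<Longrightarrow> T $$ (j, Suc j) \<noteq> 0"
proof -
  have cp: "char_poly T = (\<Prod>a\<leftarrow>diag_mat T. [:- a, 1:])"
    by (rule char_poly_upper_triangular[OF T ut])
  obtain n_as where nz: "0 \<notin> fst ` set n_as" and sim: "similar_mat T (jordan_matrix n_as)"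
    using jordan_nf_exists[OF T cp] unfolding jordan_nf_def by blast
  define J where "J = jordan_matrix n_as"
  obtain S S' where wit: "similar_mat_wit T J S S'"
    using sim unfolding similar_mat_def J_def by blast
  note w = similar_mat_witD2[OF T wit]
  have r: "r = sum_list (map fst n_as)" using w(5) by (auto simp: J_def)
  have single: "\<exists>a. n_as = [(r, a)]" if "0 < r"
  proof (cases n_as)
    case Nil
    then show ?thesis using r that by simp
  next
    case (Cons p rest)
    obtain k a where p: "p = (k, a)" by (cases p)
    show ?thesis
    proof (cases rest)
      case Nil
      then show ?thesis using Cons p r by auto
    next
      case (Cons q rest')
      obtain l b where q: "q = (l, b)" by (cases q)
      define d where "d = sum_list (map fst rest)"
      \<comment> \<open>Jordan blocks have positive size, so the first block is neither empty nor
        everything.\<close>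
      have pos: "0 < k" "0 < d" using nz \<open>n_as = p # rest\<close> p Cons q by (auto simp: d_def)
      have rk: "r = k + d" using r \<open>n_as = p # rest\<close> p by (simp add: d_def)
      \<comment> \<open>The projection onto the first Jordan block commutes with the block diagonal
        \<open>J\<close>; conjugated by \<open>S\<close> it becomes the idempotent \<open>Q\<close>
        commuting with \<open>T\<close>.\<close>
      define E where "E = four_block_mat (1\<^sub>m k) (0\<^sub>m k d) (0\<^sub>m d k) (0\<^sub>m d d :: complex mat)"
      have E: "E \<in> carrier_mat r r" by (auto simp: E_def rk)
      have Jd: "jordan_matrix rest \<in> carrier_mat d d" by (simp add: d_def)
      have J: "J = four_block_mat (jordan_block k a) (0\<^sub>m k d) (0\<^sub>m d k) (jordan_matrix rest)"
        by (simp add: J_def \<open>n_as = p # rest\<close> p jordan_matrix_def Let_def)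
          (simp add: jordan_matrix_def[symmetric] d_def)
      have EE: "E * E = E" unfolding E_def
        by (subst mult_four_block_mat[of _ k k _ d _ d]) auto
      have JE: "J * E = four_block_mat (jordan_block k a) (0\<^sub>m k d) (0\<^sub>m d k) (0\<^sub>m d d)"
        unfolding E_def J using Jd by (subst mult_four_block_mat[of _ k k _ d _ d]) auto
      have EJ: "E * J = four_block_mat (jordan_block k a) (0\<^sub>m k d) (0\<^sub>m d k) (0\<^sub>m d d)"
        unfolding E_def J using Jd by (subst mult_four_block_mat[of _ k k _ d _ d]) auto
      define Q where "Q = S * E * S'"
      note a = assoc_mult_mat[of _ r r _ r _ r]
      have canc: "S' * (S * X) = X" if "X \<in> carrier_mat r r" for X
        using that w by (metis assoc_mult_mat left_mult_one_mat)
      have Q: "Q \<in> carrier_mat r r" using w E by (simp add: Q_def)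
      have "Q * Q = S * (E * E) * S'" using w E by (simp add: Q_def a canc)
      then have "Q * Q = Q" by (simp add: EE Q_def)
      moreover have "T * Q = Q * T"
      proof -
        have "T * Q = S * (J * E) * S'" using w E by (simp add: Q_def a canc w(3))
        also have "\<dots> = S * (E * J) * S'" unfolding JE EJ ..
        also have "\<dots> = Q * T" using w E by (simp add: Q_def a canc w(3))
        finally show ?thesis .
      qed
      ultimately have "Q = 0\<^sub>m r r \<or> Q = 1\<^sub>m r" using indec Q by blast
      moreover have "S' * Q * S = E" using w E by (simp add: Q_def a canc)
      moreover have "S' * 0\<^sub>m r r * S = 0\<^sub>m r r" "S' * 1\<^sub>m r * S = 1\<^sub>m r" using w by simp_all
      ultimately have "E = 0\<^sub>m r r \<or> E = 1\<^sub>m r" by auto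
      moreover have "E $$ (0, 0) = 1" "E $$ (k, k) = 0" using pos by (auto simp: E_def)
      ultimately show ?thesis using pos rk by auto
    qed
  qed
  have diag: "T $$ (j, j) = a" if j: "j < r" and a: "n_as = [(r, a)]" for j a
  proof -
    have "char_poly T = char_poly (jordan_matrix n_as)" by (rule char_poly_similar[OF sim])
    then have "char_poly T = [:- a, 1:] ^ r" by (simp add: a jordan_matrix_char_poly)
    moreover have "poly (char_poly T) (T $$ (j, j)) = 0"
      using j T by (auto simp: cp poly_prod_list prod_list_zero_iff diag_mat_def)
    ultimately show ?thesis by simp
  qed
  show "T $$ (j, j) = T $$ (0, 0)" if "j < r" for j
    using single diag[OF that] diag[of 0] that by auto
  show "T $$ (j, Suc j) \<noteq> 0" if j: "Suc j < r" for j
  proof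
    assume z: "T $$ (j, Suc j) = 0"
    have "0 < r" using j by simp
    then obtain a where a: "n_as = [(r, a)]" using single by blast
    have Ja: "J = jordan_block r a" unfolding J_def a by (intro eq_matI) (auto simp: jordan_matrix_def)
    define N where "N = T - a \<cdot>\<^sub>m 1\<^sub>m r"
    define N' where "N' = jordan_block r (0::complex)"
    have N: "N \<in> carrier_mat r r" unfolding N_def by (intro minus_carrier_mat) simp
    have N': "N' \<in> carrier_mat r r" by (simp add: N'_def)
    have N'J: "N' = J - a \<cdot>\<^sub>m 1\<^sub>m r" by (intro eq_matI) (auto simp: N'_def Ja)
    have simN: "similar_mat_wit N N' S S'"
    proof -
      have "S * N' * S' = S * J * S' - S * (a \<cdot>\<^sub>m 1\<^sub>m r) * S'"
        unfolding N'J using w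
        by (simp add: mult_minus_distrib_mat[of _ r r _ r] minus_mult_distrib_mat[of _ r r _ _ r])
      also have "S * (a \<cdot>\<^sub>m 1\<^sub>m r) * S' = a \<cdot>\<^sub>m 1\<^sub>m r"
        using w by (simp add: mult_smult_distrib[of _ r r _ r] mult_smult_assoc_mat[of _ r r _ r])
      finally have "N = S * N' * S'" using w(3) by (simp add: N_def)
      then show ?thesis using N N' w unfolding similar_mat_wit_def Let_def by auto
    qed
    have su: "N $$ (i, l) = 0" if "i < r" "l \<le> i" for i l
    proof (cases "l = i")
      case True
      then show ?thesis using diag[OF that(1) a] that T by (simp add: N_def)
    next
      case False
      then show ?thesis using upper_triangularD[OF ut, of l i] that T by (simp add: N_def)
    qed
    have su': "N' $$ (i, l) = 0" if "i < r" "l \<le> i" for i l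
      using that by (simp add: N'_def)
    have "N $$ (j, Suc j) = 0" using z j T by (simp add: N_def)
    then have prod0: "(\<Prod>l<r - 1. N $$ (0 + l, Suc (0 + l))) = 0"
      using j by (intro prod_zero) auto
    \<comment> \<open>The only entry of this power that could survive is the corner
      \<open>(0, r - 1)\<close>, and it is the superdiagonal product containing the assumed
      zero.\<close>
    have "N ^\<^sub>m (r - 1) = 0\<^sub>m r r"
    proof (rule eq_matI)
      fix i l assume "i < dim_row (0\<^sub>m r r)" "l < dim_col (0\<^sub>m r r)"
      then have il: "i < r" "l < r" by auto
      then have "l \<le> i + (r - 1)" and eq: "l = i + (r - 1) \<Longrightarrow> i = 0" by auto
      then show "(N ^\<^sub>m (r - 1)) $$ (i, l) = 0\<^sub>m r r $$ (i, l)"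
        using strictly_upper_triangular_pow[OF N su il] prod0 il by (auto split: if_splits)
    qed (use N in auto)
    then have "N' ^\<^sub>m (r - 1) = S' * 0\<^sub>m r r * S"
      using similar_mat_wit_pow_id[OF similar_mat_wit_sym[OF simN], of "r - 1"] by simp
    then have "N' ^\<^sub>m (r - 1) = 0\<^sub>m r r" using w by simp
    \<comment> \<open>For the nilpotent Jordan block the same corner is a product of ones.\<close>
    moreover have "(N' ^\<^sub>m (r - 1)) $$ (0, r - 1) = 1"
      using strictly_upper_triangular_pow[OF N' su', of 0 "r - 1" "r - 1"] j
      by (simp add: N'_def)
    ultimately show False using j by simp
  qed
qed

section \<open>Concatenated matrices and conjugate transposes\<close>

definition append_cols :: "'a::zero mat \<Rightarrow> 'a mat \<Rightarrow> 'a mat" (infixr "@\<^sub>c" 65) where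
  "A @\<^sub>c B = four_block_mat A B (0\<^sub>m 0 (dim_col A)) (0\<^sub>m 0 (dim_col B))"

lemma carrier_append_cols [simp, intro]:
  "A \<in> carrier_mat n a \<Longrightarrow> B \<in> carrier_mat n b \<Longrightarrow> A @\<^sub>c B \<in> carrier_mat n (a + b)"
  unfolding append_cols_def by auto

lemma append_cols_mult_append_rows:
  fixes A :: "'a::semiring_0 mat"
  assumes "A \<in> carrier_mat n a" "B \<in> carrier_mat n b" "C \<in> carrier_mat a p" "D \<in> carrier_mat b p"
  shows "(A @\<^sub>c B) * (C @\<^sub>r D) = A * C + B * D"
proof -
  have "(A @\<^sub>c B) * (C @\<^sub>r D)
    = four_block_mat A B (0\<^sub>m 0 a) (0\<^sub>m 0 b) * four_block_mat C (0\<^sub>m a 0) D (0\<^sub>m b 0)"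
    using assms by (auto simp: append_cols_def append_rows_def)
  also have "\<dots> = four_block_mat (A * C + B * D) (A * 0\<^sub>m a 0 + B * 0\<^sub>m b 0)
      (0\<^sub>m 0 a * C + 0\<^sub>m 0 b * D) (0\<^sub>m 0 a * 0\<^sub>m a 0 + 0\<^sub>m 0 b * 0\<^sub>m b 0)"
    using assms by (intro mult_four_block_mat) auto
  also have "\<dots> = A * C + B * D" using assms by (intro eq_matI) auto
  finally show ?thesis .
qed

lemma append_rows_mult_append_cols:
  fixes A :: "'a::semiring_0 mat"
  assumes "A \<in> carrier_mat n a" "B \<in> carrier_mat n b" "C \<in> carrier_mat p n" "D \<in> carrier_mat q n"
  shows "(C @\<^sub>r D) * (A @\<^sub>c B) = four_block_mat (C * A) (C * B) (D * A) (D * B)"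
proof -
  have "(C @\<^sub>r D) * (A @\<^sub>c B)
    = four_block_mat C (0\<^sub>m p 0) D (0\<^sub>m q 0) * four_block_mat A B (0\<^sub>m 0 a) (0\<^sub>m 0 b)"
    using assms by (auto simp: append_cols_def append_rows_def)
  also have "\<dots> = four_block_mat (C * A + 0\<^sub>m p 0 * 0\<^sub>m 0 a) (C * B + 0\<^sub>m p 0 * 0\<^sub>m 0 b)
      (D * A + 0\<^sub>m q 0 * 0\<^sub>m 0 a) (D * B + 0\<^sub>m q 0 * 0\<^sub>m 0 b)"
    using assms by (intro mult_four_block_mat) auto
  also have "\<dots> = four_block_mat (C * A) (C * B) (D * A) (D * B)" 
    using assms by (intro eq_matI) (auto simp: scalar_prod_def)
  finally show ?thesis .
qed

lemma append_rows_mult: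
  fixes C :: "'a::semiring_0 mat"
  assumes "C \<in> carrier_mat p n" "D \<in> carrier_mat q n" "M \<in> carrier_mat n k"
  shows "(C @\<^sub>r D) * M = (C * M) @\<^sub>r (D * M)"
  using assms by (intro eq_matI) (auto simp: append_rows_def scalar_prod_def)

lemma mult_append_cols:
  fixes A :: "'a::semiring_0 mat"
  assumes "A \<in> carrier_mat n a" "B \<in> carrier_mat n b" "M \<in> carrier_mat k n"
  shows "M * (A @\<^sub>c B) = (M * A) @\<^sub>c (M * B)"
  using assms by (intro eq_matI) (auto simp: append_cols_def scalar_prod_def)

definition conj_transpose :: "complex mat \<Rightarrow> complex mat" where
  "conj_transpose A = mat (dim_col A) (dim_row A) (\<lambda>(i, j). cnj (A $$ (j, i)))"

lemma conj_transpose_carrier [simp]: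
  "A \<in> carrier_mat n m \<Longrightarrow> conj_transpose A \<in> carrier_mat m n"
  by (auto simp: conj_transpose_def)

lemma conj_transpose_mult:
  assumes "A \<in> carrier_mat n m" "B \<in> carrier_mat m k"
  shows "conj_transpose (A * B) = conj_transpose B * conj_transpose A"
  using assms by (intro eq_matI) (auto simp: conj_transpose_def scalar_prod_def mult.commute)

lemma conj_transpose_conj_transpose [simp]: "conj_transpose (conj_transpose A) = A"
  by (intro eq_matI) (auto simp: conj_transpose_def)

lemma conj_transpose_zero [simp]: "conj_transpose (0\<^sub>m n m) = 0\<^sub>m m n"
  by (intro eq_matI) (auto simp: conj_transpose_def)

lemma conj_transpose_append_cols:
  assumes "A \<in> carrier_mat n a" "B \<in> carrier_mat n b"
  shows "conj_transpose (A @\<^sub>c B) = conj_transpose A @\<^sub>r conj_transpose B"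
  using assms by (intro eq_matI) (auto simp: conj_transpose_def append_cols_def append_rows_def)

section \<open>Orthonormal bases of invariant ranges\<close>

lemma exists_unit_multiple:
  assumes v: "v \<in> carrier_vec n" "v \<noteq> 0\<^sub>v n"
  obtains b :: complex where "conj_transpose (mat_of_cols n [b \<cdot>\<^sub>v v]) * mat_of_cols n [b \<cdot>\<^sub>v v] = 1\<^sub>m 1"
proof -
  let ?s = "\<Sum>i<n. (norm (v $ i))\<^sup>2"
  obtain i where i: "i < n" "v $ i \<noteq> 0"
    using v by (metis carrier_vecD eq_vecI index_zero_vec)
  have "0 < (norm (v $ i))\<^sup>2" using i by simp
  also have "\<dots> \<le> ?s" using i by (intro member_le_sum) auto
  finally have s: "0 < ?s" .
  obtain t where t: "t * t * ?s = 1"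
    using s that[of "1 / sqrt ?s"] by (simp add: field_simps)
  define b where "b = complex_of_real t"
  have b2: "cnj b * b * complex_of_real ?s = 1"
    unfolding b_def complex_cnj_complex_of_real of_real_mult[symmetric] t by simp
  have "(\<Sum>i<n. cnj (b * v $ i) * (b * v $ i)) = cnj b * b * complex_of_real ?s"
    unfolding of_real_sum sum_distrib_left
    by (intro sum.cong) (auto simp: complex_norm_square mult_ac simp del: of_real_power)
  then have "(\<Sum>i<n. cnj (b * v $ i) * (b * v $ i)) = 1" using b2 by simp
  then have "conj_transpose (mat_of_cols n [b \<cdot>\<^sub>v v]) * mat_of_cols n [b \<cdot>\<^sub>v v] = 1\<^sub>m 1"
    using v by (intro eq_matI)
      (auto simp: conj_transpose_def scalar_prod_def mat_of_cols_def atLeast0LessThan)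
  then show thesis by (rule that)
qed

text \<open>The eigenvector is recast as a one-column matrix, so that the recursion below stays
  within matrix algebra.\<close>

lemma exists_unit_eigencolumn:
  fixes A P :: "complex mat"
  assumes A: "A \<in> carrier_mat n n" and P: "P \<in> carrier_mat n n"
    and "P * P = P" "P * (A * P) = A * P" "P \<noteq> 0\<^sub>m n n"
  obtains V c where "V \<in> carrier_mat n 1" "conj_transpose V * V = 1\<^sub>m 1" "P * V = V" "A * V = c \<cdot>\<^sub>m V"
proof -
  obtain v c where v: "v \<in> carrier_vec n" "v \<noteq> 0\<^sub>v n" "P *\<^sub>v v = v" "A *\<^sub>v v = c \<cdot>\<^sub>v v"
    by (rule eigenvector_in_invariant_range[OF assms])
  obtain b where b: "conj_transpose (mat_of_cols n [b \<cdot>\<^sub>v v]) * mat_of_cols n [b \<cdot>\<^sub>v v] = 1\<^sub>m 1"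
    by (rule exists_unit_multiple[OF v(1,2)])
  let ?V = "mat_of_cols n [b \<cdot>\<^sub>v v]"
  have col: "M * ?V = mat_of_cols n [b \<cdot>\<^sub>v (M *\<^sub>v v)]" if M: "M \<in> carrier_mat n n" for M
    using M v(1) by (intro eq_matI) (auto simp: mat_of_cols_def scalar_prod_def sum_distrib_left mult_ac)
  show thesis
  proof (rule that[of ?V c])
    show "?V \<in> carrier_mat n 1" by (simp add: mat_of_cols_def)
    show "P * ?V = ?V" using col[OF P] v(3) by simp
    show "A * ?V = c \<cdot>\<^sub>m ?V"
      using col[OF A] v(1,4) by (intro eq_matI) (auto simp: mat_of_cols_def mult_ac)
  qed (rule b)
qed

text \<open>
  The columns of \<open>Z\<close> are the unit vectors split off so far; since they are orthonormal, at most \<open>N = n - l\<close>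
  further ones exist, which bounds the recursion.  Splitting off a unit eigenvector \<open>v\<close> in the range
  of \<open>P\<close> replaces \<open>P\<close> and \<open>A\<close> by \<open>E * P\<close> and \<open>E * A\<close> with \<open>E = 1 - v v\<^sup>*\<close>.
\<close>

lemma orthonormal_triangular_basis_aux:
  fixes A P Z :: "complex mat"
  assumes "A \<in> carrier_mat n n" "P \<in> carrier_mat n n"
    and "P * P = P" "P * (A * P) = A * P"
    and "Z \<in> carrier_mat n l" "conj_transpose Z * Z = 1\<^sub>m l" "conj_transpose Z * P = 0\<^sub>m l n"
    and "l + N = n"
  shows "\<exists>r Y. Y \<in> carrier_mat n r \<and> conj_transpose Y * Y = 1\<^sub>m r \<and> P * Y = Y \<and>
    Y * (conj_transpose Y * P) = P \<and> upper_triangular (conj_transpose Y * (A * Y))"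
  using assms
proof (induction N arbitrary: A P Z l)
  case 0
  then have n: "l = n" by simp
  have Z: "Z \<in> carrier_mat n n" using 0(5) n by simp
  \<comment> \<open>No room is left: \<open>Z\<close> is square, hence unitary, and a
    \<open>P\<close> whose columns are orthogonal to all columns of \<open>Z\<close> is 0.\<close>
  have "Z * conj_transpose Z = 1\<^sub>m n"
    using mat_mult_left_right_inverse[OF conj_transpose_carrier[OF Z] Z] 0(6) n by simp
  then have "P = Z * conj_transpose Z * P" using 0(2) by simp
  also have "\<dots> = Z * (conj_transpose Z * P)"
    by (rule assoc_mult_mat[OF Z conj_transpose_carrier[OF Z] 0(2)])
  finally have P: "P = 0\<^sub>m n n" using 0(7) Z n by simp
  show ?case
    by (rule exI[of _ 0], rule exI[of _ "0\<^sub>m n 0"]) (use 0(1) P in auto)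
next
  case (Suc N)
  note A = Suc.prems(1) and P = Suc.prems(2) and Z = Suc.prems(5)
  show ?case
  proof (cases "P = 0\<^sub>m n n")
    case True
    show ?thesis
      by (rule exI[of _ 0], rule exI[of _ "0\<^sub>m n 0"]) (use A True in auto)
  next
    case False
    obtain V c where V: "V \<in> carrier_mat n 1" and VV: "conj_transpose V * V = 1\<^sub>m 1"
      and PV: "P * V = V" and AV: "A * V = c \<cdot>\<^sub>m V"
      by (rule exists_unit_eigencolumn[OF Suc.prems(1-4) False])
    define H where "H = conj_transpose V"
    have H: "H \<in> carrier_mat 1 n" using V by (simp add: H_def)
    have HV: "H * V = 1\<^sub>m 1" using VV by (simp add: H_def)
    define F where "F = V * H"
    have F: "F \<in> carrier_mat n n" using V H by (simp add: F_def)
    define E where "E = 1\<^sub>m n - F"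
    have E: "E \<in> carrier_mat n n" unfolding E_def by (rule minus_carrier_mat[OF F])
    have PF: "P * F = F" using assoc_mult_mat[OF P V H] PV by (simp add: F_def)
    have AF: "A * F = c \<cdot>\<^sub>m F"
      using assoc_mult_mat[OF A V H] AV mult_smult_assoc_mat[OF V H] by (simp add: F_def)
    have HF: "H * F = H" using assoc_mult_mat[OF H V H] HV H by (simp add: F_def)
    have FF: "F * F = F" using assoc_mult_mat[OF V H F] HF by (simp add: F_def)
    have E_mult: "E * X = X - F * X" if "X \<in> carrier_mat n k" for X k
      using minus_mult_distrib_mat[OF one_carrier_mat F that] that by (simp add: E_def)
    have mult_E: "X * E = X - X * F" if "X \<in> carrier_mat k n" for X k
      using mult_minus_distrib_mat[OF that one_carrier_mat F] that by (simp add: E_def)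
    have minus0: "X - 0\<^sub>m j k = X" if "X \<in> carrier_mat j k" for X :: "complex mat" and j k
      using that by (intro eq_matI) auto
    have EE: "E * E = E"
    proof -
      have "F * E = 0\<^sub>m n n" using mult_E[OF F] FF F by simp
      then show ?thesis using E_mult[OF E] minus0[OF E] by simp
    qed
    have HE: "H * E = 0\<^sub>m 1 n" using mult_E[OF H] HF H by simp
    have EP: "E * P \<in> carrier_mat n n" and EA: "E * A \<in> carrier_mat n n" using E P A by auto
    \<comment> \<open>\<open>E\<close> need not commute with \<open>P\<close>, but it maps the range
      of \<open>P\<close> into itself because the subtracted part \<open>F\<close> has its range
      there.\<close>
    have PE: "P * (E * X) = E * X" if X: "X \<in> carrier_mat n n" and PX: "P * X = X" for X
    proof -
      have "P * (E * X) = P * X - P * (F * X)"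
        unfolding E_mult[OF X] using mult_minus_distrib_mat[OF P X, of "F * X"] F X by simp
      also have "P * (F * X) = F * X" using assoc_mult_mat[OF P F X] PF by simp
      finally show ?thesis using PX E_mult[OF X] by simp
    qed
    \<comment> \<open>Invariance for the new pair reduces to \<open>P * W = W\<close>. It holds
      because \<open>W\<close> differs from \<open>A * P\<close> by a multiple of
      \<open>F * P\<close>, the columns of \<open>F\<close> being eigenvectors of
      \<open>A\<close>.\<close>
    define W where "W = A * (E * P)"
    have W: "W \<in> carrier_mat n n" using A EP by (simp add: W_def)
    have PW: "P * W = W"
    proof -
      have FP: "F * P \<in> carrier_mat n n" using F P by simp
      have AP: "A * P \<in> carrier_mat n n" using A P by simp
      have cFP: "c \<cdot>\<^sub>m (F * P) \<in> carrier_mat n n" using FP by simp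
      have "W = A * P - A * (F * P)"
        unfolding W_def E_mult[OF P] by (rule mult_minus_distrib_mat[OF A P FP])
      also have "A * (F * P) = c \<cdot>\<^sub>m (F * P)"
        using assoc_mult_mat[OF A F P] AF mult_smult_assoc_mat[OF F P] by simp
      finally have W': "W = A * P - c \<cdot>\<^sub>m (F * P)" .
      have "P * W = P * (A * P) - P * (c \<cdot>\<^sub>m (F * P))"
        unfolding W' by (rule mult_minus_distrib_mat[OF P AP cFP])
      also have "P * (c \<cdot>\<^sub>m (F * P)) = c \<cdot>\<^sub>m (F * P)"
        using mult_smult_distrib[OF P FP] assoc_mult_mat[OF P F P] PF by simp
      finally show ?thesis using Suc.prems(4) W' by simp
    qed
    have idem: "(E * P) * (E * P) = E * P"
      using assoc_mult_mat[OF E P EP] PE[OF P Suc.prems(3)] assoc_mult_mat[OF E E P] EE by simp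
    have inv: "(E * P) * ((E * A) * (E * P)) = (E * A) * (E * P)"
    proof -
      have EW: "(E * A) * (E * P) = E * W" using assoc_mult_mat[OF E A EP] by (simp add: W_def)
      have "(E * P) * (E * W) = E * (P * (E * W))" using E P W by (intro assoc_mult_mat) auto
      also have "\<dots> = E * W" using PE[OF W PW] assoc_mult_mat[OF E E W] EE by simp
      finally show ?thesis using EW by simp
    qed
    define K where "K = conj_transpose Z"
    have K: "K \<in> carrier_mat l n" using Z by (simp add: K_def)
    \<comment> \<open>\<open>V = P * V\<close> lies in the range of \<open>P\<close>, to which the
      columns of \<open>Z\<close> are orthogonal. So \<open>Z\<close> extended by \<open>V\<close>
      stays orthonormal.\<close>
    have KV: "K * V = 0\<^sub>m l 1"
      using assoc_mult_mat[OF K P V] PV Suc.prems(7) V by (simp add: K_def)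
    have HZ: "H * Z = 0\<^sub>m 1 l"
      using conj_transpose_mult[OF K V] KV by (simp add: K_def H_def)
    have KE: "K * E = K"
      using mult_E[OF K] assoc_mult_mat[OF K V H] KV K H minus0[OF K] by (simp add: F_def)
    have ZV: "Z @\<^sub>c V \<in> carrier_mat n (Suc l)" using carrier_append_cols[OF Z V] by simp
    have ct: "conj_transpose (Z @\<^sub>c V) = K @\<^sub>r H"
      using conj_transpose_append_cols[OF Z V] by (simp add: K_def H_def)
    have "conj_transpose (Z @\<^sub>c V) * (Z @\<^sub>c V) = four_block_mat (1\<^sub>m l) (0\<^sub>m l 1) (0\<^sub>m 1 l) (1\<^sub>m 1)"
      unfolding ct append_rows_mult_append_cols[OF Z V K H]
      using KV HZ HV Suc.prems(6) by (simp add: K_def)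
    then have ortho: "conj_transpose (Z @\<^sub>c V) * (Z @\<^sub>c V) = 1\<^sub>m (Suc l)" by simp
    have "conj_transpose (Z @\<^sub>c V) * (E * P) = (K * (E * P)) @\<^sub>r (H * (E * P))"
      unfolding ct by (rule append_rows_mult[OF K H EP])
    also have "K * (E * P) = 0\<^sub>m l n"
      using assoc_mult_mat[OF K E P] KE Suc.prems(7) by (simp add: K_def)
    also have "H * (E * P) = 0\<^sub>m 1 n" using assoc_mult_mat[OF H E P] HE P by simp
    also have "0\<^sub>m l n @\<^sub>r 0\<^sub>m 1 n = 0\<^sub>m (Suc l) n"
      by (intro eq_matI) (auto simp: append_rows_def)
    finally have perp: "conj_transpose (Z @\<^sub>c V) * (E * P) = 0\<^sub>m (Suc l) n" .
    obtain r Y where Y: "Y \<in> carrier_mat n r" and YY: "conj_transpose Y * Y = 1\<^sub>m r"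
      and EPY: "(E * P) * Y = Y" and YYEP: "Y * (conj_transpose Y * (E * P)) = E * P"
      and tri: "upper_triangular (conj_transpose Y * ((E * A) * Y))"
      using Suc.IH[OF EA EP idem inv ZV ortho perp] Suc.prems(8) by auto
    define L where "L = conj_transpose Y"
    have L: "L \<in> carrier_mat r n" using Y by (simp add: L_def)
    have PY: "P * Y = Y"
      using assoc_mult_mat[OF P EP Y] PE[OF P Suc.prems(3)] EPY by simp
    have HY: "H * Y = 0\<^sub>m 1 r"
    proof -
      have "H * (E * P) = 0\<^sub>m 1 n" using assoc_mult_mat[OF H E P] HE P by simp
      then show ?thesis using assoc_mult_mat[OF H EP Y] EPY Y by simp
    qed
    have LV: "L * V = 0\<^sub>m r 1"
      using conj_transpose_mult[OF H Y] HY by (simp add: L_def H_def)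
    have LE: "L * E = L"
      using mult_E[OF L] assoc_mult_mat[OF L V H] LV L H minus0[OF L] by (simp add: F_def)
    have LEX: "L * (E * X) = L * X" if "X \<in> carrier_mat n k" for X k
      using assoc_mult_mat[OF L E that] LE by simp
    have YV: "V @\<^sub>c Y \<in> carrier_mat n (1 + r)" by (rule carrier_append_cols[OF V Y])
    have ctY: "conj_transpose (V @\<^sub>c Y) = H @\<^sub>r L"
      using conj_transpose_append_cols[OF V Y] by (simp add: L_def H_def)
    have "conj_transpose (V @\<^sub>c Y) * (V @\<^sub>c Y) = four_block_mat (1\<^sub>m 1) (0\<^sub>m 1 r) (0\<^sub>m r 1) (1\<^sub>m r)"
      unfolding ctY append_rows_mult_append_cols[OF V Y H L]
      using HY LV HV YY by (simp add: L_def)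
    then have c1: "conj_transpose (V @\<^sub>c Y) * (V @\<^sub>c Y) = 1\<^sub>m (1 + r)" by simp
    have c2: "P * (V @\<^sub>c Y) = V @\<^sub>c Y" using mult_append_cols[OF V Y P] PV PY by simp
    \<comment> \<open>The two summands are \<open>F * P\<close> and \<open>E * P\<close>. The second
      comes from the induction hypothesis, since \<open>L * E = L\<close>.\<close>
    have c3: "(V @\<^sub>c Y) * (conj_transpose (V @\<^sub>c Y) * P) = P"
    proof -
      have "(V @\<^sub>c Y) * (conj_transpose (V @\<^sub>c Y) * P) = V * (H * P) + Y * (L * P)"
        unfolding ctY append_rows_mult[OF H L P]
        using append_cols_mult_append_rows[OF V Y, of "H * P" n "L * P"] H L P by simp
      also have "V * (H * P) = F * P" using assoc_mult_mat[OF V H P] by (simp add: F_def)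
      also have "Y * (L * P) = P - F * P" using YYEP LEX[OF P] E_mult[OF P] by (simp add: L_def)
      also have "F * P + (P - F * P) = P" using F P by (intro eq_matI) auto
      finally show ?thesis .
    qed
    have AY: "A * Y \<in> carrier_mat n r" using A Y by simp
    have AV': "A * V \<in> carrier_mat n 1" using A V by simp
    \<comment> \<open>The lower left block vanishes because \<open>A * V\<close> is a multiple of
      \<open>V\<close>, to which the columns of \<open>Y\<close> are orthogonal; in the lower right
      block \<open>L\<close> absorbs \<open>E\<close>.\<close>
    have c4: "upper_triangular (conj_transpose (V @\<^sub>c Y) * (A * (V @\<^sub>c Y)))"
    proof -
      have "L * (A * V) = 0\<^sub>m r 1" using AV mult_smult_distrib[OF L V] LV by simp
      moreover have "L * (A * Y) = L * ((E * A) * Y)"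
        using assoc_mult_mat[OF E A Y] LEX[OF AY] by simp
      ultimately have "conj_transpose (V @\<^sub>c Y) * (A * (V @\<^sub>c Y))
        = four_block_mat (H * (A * V)) (H * (A * Y)) (0\<^sub>m r 1) (L * ((E * A) * Y))"
        unfolding ctY mult_append_cols[OF V Y A] append_rows_mult_append_cols[OF AV' AY H L] by simp
      moreover have "upper_triangular (H * (A * V))" using H AV' by (intro upper_triangularI) auto
      moreover have "H * (A * V) \<in> carrier_mat 1 1" "L * ((E * A) * Y) \<in> carrier_mat r r"
        using H L AV' EA Y by auto
      ultimately show ?thesis
        using upper_triangular_four_block[of "H * (A * V)" 1 "L * ((E * A) * Y)" r "H * (A * Y)"] tri
        by (simp only: L_def)
    qed
    show ?thesis using YV c1 c2 c3 c4 by blast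
  qed
qed

text \<open>The range of \<open>P\<close> has an orthonormal basis \<open>Y\<close>, but
  \<open>P\<close> may be oblique, so the dual coordinates are \<open>conj_transpose Y * P\<close>
  and not just \<open>conj_transpose Y\<close>. Unit columns bound the entries of \<open>Y\<close>
  by 1, and then each entry of \<open>X\<close> is a sum of \<open>n\<close> terms of norm at most
  \<open>C\<close>.\<close>

lemma bounded_triangularization_of_range:
  fixes A P :: "complex mat"
  assumes A: "A \<in> carrier_mat n n" and P: "P \<in> carrier_mat n n"
    and idem: "P * P = P" and comm: "A * P = P * A"
    and bound: "\<And>i j. i < n \<Longrightarrow> j < n \<Longrightarrow> norm (P $$ (i, j)) \<le> C"
  obtains r X Y where "X \<in> carrier_mat r n" "Y \<in> carrier_mat n r"
    "X * Y = 1\<^sub>m r" "Y * X = P" "upper_triangular (X * A * Y)"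
    "\<And>i j. i < n \<Longrightarrow> j < r \<Longrightarrow> norm (Y $$ (i, j)) \<le> 1"
    "\<And>i j. i < r \<Longrightarrow> j < n \<Longrightarrow> norm (X $$ (i, j)) \<le> n * C"
proof -
  have "1\<^sub>m 0 = (0\<^sub>m 0 0 :: complex mat)" by (intro eq_matI) auto
  moreover have "P * (A * P) = A * P" using comm idem assoc_mult_mat[OF P P A] by simp
  ultimately obtain r Y where Y: "Y \<in> carrier_mat n r" and YY: "conj_transpose Y * Y = 1\<^sub>m r"
    and PY: "P * Y = Y" and YYP: "Y * (conj_transpose Y * P) = P"
    and tri: "upper_triangular (conj_transpose Y * (A * Y))"
    using orthonormal_triangular_basis_aux[OF A P idem, of "0\<^sub>m n 0" 0 n] P by auto
  define L where "L = conj_transpose Y"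
  have L: "L \<in> carrier_mat r n" using Y by (simp add: L_def)
  have Yb: "norm (Y $$ (i, j)) \<le> 1" if ij: "i < n" "j < r" for i j
  proof -
    have "(\<Sum>k<n. cnj (Y $$ (k, j)) * Y $$ (k, j)) = (L * Y) $$ (j, j)"
      using Y ij by (simp add: L_def conj_transpose_def scalar_prod_def atLeast0LessThan)
    also have "\<dots> = 1" using YY ij by (simp add: L_def)
    finally have "complex_of_real (\<Sum>k<n. (norm (Y $$ (k, j)))\<^sup>2) = 1"
      by (simp add: complex_norm_square mult.commute del: of_real_power)
    then have "(\<Sum>k<n. (norm (Y $$ (k, j)))\<^sup>2) = 1" by (metis of_real_eq_1_iff)
    moreover have "(norm (Y $$ (i, j)))\<^sup>2 \<le> (\<Sum>k<n. (norm (Y $$ (k, j)))\<^sup>2)"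
      using ij by (intro member_le_sum) auto
    ultimately show ?thesis by (simp add: power_le_one_iff)
  qed
  show thesis
  proof (rule that[of "L * P" r Y])
    show "L * P \<in> carrier_mat r n" using L P by simp
    show "L * P * Y = 1\<^sub>m r" using assoc_mult_mat[OF L P Y] PY YY by (simp add: L_def)
    show "Y * (L * P) = P" using YYP by (simp add: L_def)
    have "L * P * A * Y = L * (A * Y)"
    proof -
      have AP: "A * P \<in> carrier_mat n n" using A P by simp
      have "L * P * A = L * (A * P)" using assoc_mult_mat[OF L P A] comm by simp
      then have "L * P * A * Y = L * ((A * P) * Y)" using assoc_mult_mat[OF L AP Y] by simp
      then show ?thesis using assoc_mult_mat[OF A P Y] PY by simp
    qed
    then show "upper_triangular (L * P * A * Y)" using tri by (simp add: L_def)
    show "norm ((L * P) $$ (i, j)) \<le> n * C" if "i < r" "j < n" for i j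
    proof -
      have "(L * P) $$ (i, j) = (\<Sum>k<n. cnj (Y $$ (k, i)) * P $$ (k, j))"
        using that Y P by (simp add: L_def conj_transpose_def scalar_prod_def atLeast0LessThan)
      also have "norm \<dots> \<le> (\<Sum>k<n. 1 * C)"
      proof (rule sum_norm_le)
        fix k assume "k \<in> {..<n}"
        then show "norm (cnj (Y $$ (k, i)) * P $$ (k, j)) \<le> 1 * C"
          unfolding norm_mult complex_mod_cnj using Yb[of k i] bound[of k j] that
          by (intro mult_mono) auto
      qed
      finally show ?thesis by simp
    qed
  qed (use Y Yb in auto)
qed

subsection \<open>Indecomposability of the frame idempotents\<close>

lemma Linf_const: "(\<lambda>x. c) \<in> Linf M"
  by (auto simp: Linf_def)

lemma Linf_mult:
  assumes "f \<in> Linf M" "g \<in> Linf M"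
  shows "(\<lambda>x. f x * g x) \<in> Linf M"
proof -
  obtain a b where ab: "AE x in M. norm (f x) \<le> a" "AE x in M. norm (g x) \<le> b"
    using assms unfolding Linf_def by auto
  then have "AE x in M. norm (f x * g x) \<le> a * b"
  proof eventually_elim
    case (elim x)
    then show ?case unfolding norm_mult by (intro mult_mono) (auto intro: order_trans[OF norm_ge_zero])
  qed
  then show ?thesis using assms unfolding Linf_def by auto
qed

lemma Linf_add:
  assumes "f \<in> Linf M" "g \<in> Linf M"
  shows "(\<lambda>x. f x + g x) \<in> Linf M"
proof -
  obtain a b where ab: "AE x in M. norm (f x) \<le> a" "AE x in M. norm (g x) \<le> b"
    using assms unfolding Linf_def by auto
  then have "AE x in M. norm (f x + g x) \<le> a + b"
    by eventually_elim (rule norm_triangle_mono)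
  then show ?thesis using assms unfolding Linf_def by auto
qed

lemma Linf_sum:
  assumes "\<And>i. i \<in> I \<Longrightarrow> f i \<in> Linf M"
  shows "(\<lambda>x. \<Sum>i\<in>I. f i x) \<in> Linf M"
  using assms
  by (induction I rule: infinite_finite_induct) (auto intro: Linf_add simp: Linf_const)

lemma Linf_mat_carrier: "B \<in> Linf_mat M n \<Longrightarrow> x \<in> space M \<Longrightarrow> B x \<in> carrier_mat n n"
  by (auto simp: Linf_mat_def)

lemma Linf_mat_measurable:
  "B \<in> Linf_mat M n \<Longrightarrow> i < n \<Longrightarrow> j < n \<Longrightarrow> (\<lambda>x. B x $$ (i, j)) \<in> borel_measurable M"
  by (auto simp: Linf_mat_def Linf_def)

lemma Linf_mat_bounded:
  assumes B: "B \<in> Linf_mat M n"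
  obtains C where "0 \<le> C" "AE x in M. \<forall>i<n. \<forall>j<n. norm (B x $$ (i, j)) \<le> C"
proof -
  have "\<exists>c. AE x in M. norm (B x $$ (i, j)) \<le> c" if "i < n" "j < n" for i j
    using B that unfolding Linf_mat_def Linf_def by blast
  then obtain c where c: "\<And>i j. i < n \<Longrightarrow> j < n \<Longrightarrow> AE x in M. norm (B x $$ (i, j)) \<le> c i j"
    by metis
  let ?C = "\<Sum>i<n. \<Sum>j<n. \<bar>c i j\<bar>"
  have le: "c i j \<le> ?C" if "i < n" "j < n" for i j
  proof -
    have "c i j \<le> (\<Sum>j<n. \<bar>c i j\<bar>)"
      using member_le_sum[of j "{..<n}" "\<lambda>j. \<bar>c i j\<bar>"] that by auto
    also have "\<dots> \<le> ?C"
      using member_le_sum[of i "{..<n}" "\<lambda>i. \<Sum>j<n. \<bar>c i j\<bar>"] that by (auto simp: sum_nonneg)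
    finally show ?thesis .
  qed
  have "AE x in M. \<forall>i\<in>{..<n}. \<forall>j\<in>{..<n}. norm (B x $$ (i, j)) \<le> ?C"
  proof (intro AE_finite_allI)
    fix i j assume "i \<in> {..<n}" "j \<in> {..<n}"
    then have ij: "i < n" "j < n" by auto
    show "AE x in M. norm (B x $$ (i, j)) \<le> ?C"
      using c[OF ij] by eventually_elim (use le[OF ij] in simp)
  qed auto
  then have "AE x in M. \<forall>i<n. \<forall>j<n. norm (B x $$ (i, j)) \<le> ?C" by eventually_elim auto
  then show thesis by (intro that[of ?C]) (auto simp: sum_nonneg)
qed

lemma mult_entry:
  assumes "A \<in> carrier_mat n k" "B \<in> carrier_mat k m" "i < n" "j < m"
  shows "(A * B) $$ (i, j) = (\<Sum>l<k. A $$ (i, l) * B $$ (l, j))"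
  using assms by (simp add: scalar_prod_def atLeast0LessThan)

lemma mat_eq_iff_entries:
  assumes "A \<in> carrier_mat n m" "B \<in> carrier_mat n m"
  shows "A = B \<longleftrightarrow> (\<forall>i<n. \<forall>j<m. A $$ (i, j) = B $$ (i, j))"
  using assms by (auto intro!: eq_matI)

text \<open>
  Compactness needs closed conditions on the idempotent, so \<open>Q \<noteq> 0\<close> and \<open>Q \<noteq> R\<close> are replaced by lower
  bounds \<open>e\<close> on the distances (\<open>t = 4\<close> and \<open>t = 5\<close>).
\<close>

definition idempotent_defect ::
  "nat \<Rightarrow> complex mat \<Rightarrow> complex mat \<Rightarrow> real \<Rightarrow> nat \<times> nat \<times> nat \<Rightarrow> (nat \<times> nat \<Rightarrow> complex) \<Rightarrow> complex"
where
  "idempotent_defect n A R e = (\<lambda>(t, i, j) g.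
    if t = 0 then (\<Sum>l<n. g (i, l) * g (l, j)) - g (i, j)
    else if t = 1 then (\<Sum>l<n. A $$ (i, l) * g (l, j)) - (\<Sum>l<n. g (i, l) * A $$ (l, j))
    else if t = 2 then (\<Sum>l<n. g (i, l) * R $$ (l, j)) - g (i, j)
    else if t = 3 then (\<Sum>l<n. R $$ (i, l) * g (l, j)) - g (i, j)
    else if t = 4 then of_real (max 0 (e - (\<Sum>a<n. \<Sum>b<n. norm (g (a, b)))))
    else of_real (max 0 (e - (\<Sum>a<n. \<Sum>b<n. norm (g (a, b) - R $$ (a, b))))))"

text \<open>With \<open>e > 0\<close> this is a quantitative witness of decomposability: a commuting
  idempotent below \<open>R\<close> other than 0 and \<open>R\<close> satisfies it for all
  sufficiently small \<open>e\<close>.\<close>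

definition separated_subidempotent :: "nat \<Rightarrow> complex mat \<Rightarrow> complex mat \<Rightarrow> real \<Rightarrow> complex mat \<Rightarrow> bool" where
  "separated_subidempotent n A R e Q \<longleftrightarrow> Q * Q = Q \<and> A * Q = Q * A \<and> Q * R = Q \<and> R * Q = Q \<and>
    e \<le> (\<Sum>a<n. \<Sum>b<n. norm (Q $$ (a, b))) \<and>
    e \<le> (\<Sum>a<n. \<Sum>b<n. norm (Q $$ (a, b) - R $$ (a, b)))"

lemma idempotent_defect_zero_iff:
  assumes n: "0 < n" and A: "A \<in> carrier_mat n n" and R: "R \<in> carrier_mat n n"
  shows "(\<forall>c\<in>{..<6} \<times> {..<n} \<times> {..<n}. idempotent_defect n A R e c g = 0) \<longleftrightarrow>
    separated_subidempotent n A R e (mat n n g)"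
proof -
  let ?Q = "mat n n g"
  have Q: "?Q \<in> carrier_mat n n" by simp
  have six: "(\<forall>t<6. p t) \<longleftrightarrow> p 0 \<and> p 1 \<and> p 2 \<and> p 3 \<and> p 4 \<and> p (5::nat)" for p
  proof -
    have "t < 6 \<longleftrightarrow> t = 0 \<or> t = 1 \<or> t = 2 \<or> t = 3 \<or> t = 4 \<or> t = 5" for t :: nat by arith
    then show ?thesis by metis
  qed
  have "(\<forall>c\<in>{..<6} \<times> {..<n} \<times> {..<n}. idempotent_defect n A R e c g = 0) \<longleftrightarrow>
     (\<forall>t<6. \<forall>i<n. \<forall>j<n. idempotent_defect n A R e (t, i, j) g = 0)"
    by auto
  also have "\<dots> \<longleftrightarrow> separated_subidempotent n A R e ?Q"
    unfolding six separated_subidempotent_def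
  proof (intro arg_cong2[where f = conj])
    show "(\<forall>i<n. \<forall>j<n. idempotent_defect n A R e (0, i, j) g = 0) = (?Q * ?Q = ?Q)"
      unfolding mat_eq_iff_entries[OF mult_carrier_mat[OF Q Q] Q]
      by (simp add: mult_entry[OF Q Q] idempotent_defect_def del: index_mult_mat(1))
    show "(\<forall>i<n. \<forall>j<n. idempotent_defect n A R e (1, i, j) g = 0) = (A * ?Q = ?Q * A)"
      unfolding mat_eq_iff_entries[OF mult_carrier_mat[OF A Q] mult_carrier_mat[OF Q A]]
      by (simp add: mult_entry[OF Q A] mult_entry[OF A Q] idempotent_defect_def
          del: index_mult_mat(1))
    show "(\<forall>i<n. \<forall>j<n. idempotent_defect n A R e (2, i, j) g = 0) = (?Q * R = ?Q)"
      unfolding mat_eq_iff_entries[OF mult_carrier_mat[OF Q R] Q]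
      by (simp add: mult_entry[OF Q R] idempotent_defect_def del: index_mult_mat(1))
    show "(\<forall>i<n. \<forall>j<n. idempotent_defect n A R e (3, i, j) g = 0) = (R * ?Q = ?Q)"
      unfolding mat_eq_iff_entries[OF mult_carrier_mat[OF R Q] Q]
      by (simp add: mult_entry[OF R Q] idempotent_defect_def del: index_mult_mat(1))
    \<comment> \<open>The last two conditions do not depend on \<open>i\<close> and
      \<open>j\<close>; \<open>0 < n\<close> guarantees that they are imposed at least once.\<close>
    show "(\<forall>i<n. \<forall>j<n. idempotent_defect n A R e (4, i, j) g = 0)
      = (e \<le> (\<Sum>a<n. \<Sum>b<n. norm (?Q $$ (a, b))))"
      using n by (auto simp: idempotent_defect_def max_def)
    show "(\<forall>i<n. \<forall>j<n. idempotent_defect n A R e (5, i, j) g = 0)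
      = (e \<le> (\<Sum>a<n. \<Sum>b<n. norm (?Q $$ (a, b) - R $$ (a, b))))"
      using n by (auto simp: idempotent_defect_def max_def)
  qed
  finally show ?thesis .
qed

lemma idempotent_defect_continuous: "continuous_on UNIV (idempotent_defect n A R e c)"
proof -
  obtain t i j where c: "c = (t, i, j)" by (cases c)
  consider "t = 0" | "t = 1" | "t = 2" | "t = 3" | "t = 4" | "t \<notin> {0, 1, 2, 3, 4}" by blast
  then show ?thesis unfolding c idempotent_defect_def prod.case
    by cases (simp_all, (intro continuous_intros continuous_on_product_coordinates)+)
qed

lemma idempotent_defect_measurable:
  assumes "\<And>i j. i < n \<Longrightarrow> j < n \<Longrightarrow> (\<lambda>x. A x $$ (i, j)) \<in> borel_measurable M"
    and "\<And>i j. i < n \<Longrightarrow> j < n \<Longrightarrow> (\<lambda>x. R x $$ (i, j)) \<in> borel_measurable M"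
    and "c \<in> {..<6} \<times> {..<n} \<times> {..<n}"
  shows "(\<lambda>x. idempotent_defect n (A x) (R x) e c g) \<in> borel_measurable M"
proof -
  obtain t i j where c: "c = (t, i, j)" by (cases c)
  then have ij: "i < n" "j < n" using assms(3) by auto
  have "(\<lambda>x. \<Sum>l<n. A x $$ (i, l) * g (l, j)) \<in> borel_measurable M"
    "(\<lambda>x. \<Sum>l<n. g (i, l) * A x $$ (l, j)) \<in> borel_measurable M"
    "(\<lambda>x. \<Sum>l<n. g (i, l) * R x $$ (l, j)) \<in> borel_measurable M"
    "(\<lambda>x. \<Sum>l<n. R x $$ (i, l) * g (l, j)) \<in> borel_measurable M"
    "(\<lambda>x. \<Sum>a<n. \<Sum>b<n. norm (g (a, b) - R x $$ (a, b))) \<in> borel_measurable M"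
    using assms(1,2) ij
    by (auto intro!: borel_measurable_sum borel_measurable_times borel_measurable_diff borel_measurable_norm)
  note [measurable] = this
  consider "t = 0" | "t = 1" | "t = 2" | "t = 3" | "t = 4" | "t \<notin> {0, 1, 2, 3, 4}" by blast
  then show ?thesis unfolding c idempotent_defect_def prod.case
    by cases simp_all
qed

section \<open>Null sets of decomposable points\<close>

lemma AE_completion_in_support:
  assumes "finite_regular_borel_on \<Lambda> \<nu>"
  shows "AE x in completion \<nu>. x \<in> \<Lambda>"
proof -
  have sets: "sets \<nu> = sets borel" and null: "emeasure \<nu> (- \<Lambda>) = 0" and \<Lambda>: "compact \<Lambda>"
    using assms by (auto simp: finite_regular_borel_on_def)
  have "- \<Lambda> \<in> sets \<nu>" unfolding sets by (intro borel_comp borel_closed compact_imp_closed \<Lambda>)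
  then have "- \<Lambda> \<in> null_sets \<nu>" using null by (intro null_setsI)
  then have "AE x in \<nu>. x \<notin> - \<Lambda>" by (rule AE_not_in)
  then show ?thesis by (intro AE_completion) simp
qed

text \<open>Over the set of points with such a witness, the witnesses can be chosen measurably. They
  form an idempotent below \<open>P k\<close> in the relative commutant over that set, nowhere zero
  and nowhere equal to \<open>P k\<close>. Minimality of \<open>P k\<close> there leaves only the
  possibility that the set is null.\<close>

lemma AE_no_separated_subidempotent:
  fixes P :: "nat \<Rightarrow> complex \<Rightarrow> complex mat"
  assumes reg: "finite_regular_borel_on \<Lambda> \<nu>" and \<mu>: "\<mu> = completion \<nu>" and n: "0 < n"
    and A: "A \<in> Linf_mat \<mu> n" and frame: "finite_frame \<Lambda> \<mu> n A m P" and k: "k < m"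
    and e: "0 < e"
  shows "AE x in \<mu>. \<not> (\<exists>g. (\<forall>i. norm (g i) \<le> C) \<and>
    separated_subidempotent n (A x) (P k x) e (mat n n g))"
proof -
  let ?S = "{..<6} \<times> {..<n} \<times> {..<n} :: (nat \<times> nat \<times> nat) set"
  let ?d = "\<lambda>c x. idempotent_defect n (A x) (P k x) e c"
  have sets: "sets \<nu> = sets borel" and \<Lambda>: "compact \<Lambda>"
    using reg by (auto simp: finite_regular_borel_on_def)
  have space: "space \<mu> = UNIV" using sets_eq_imp_space_eq[OF sets] by (simp add: \<mu>)
  have P: "P k \<in> Linf_mat \<mu> n" and commP: "AE x in \<mu>. A x * P k x = P k x * A x"
    using frame k by (auto simp: finite_frame_def rel_commutant_def)
  have cA: "A x \<in> carrier_mat n n" and cP: "P k x \<in> carrier_mat n n" for x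
    using Linf_mat_carrier[OF A] Linf_mat_carrier[OF P] space by auto
  have meas: "(\<lambda>x. ?d c x g) \<in> borel_measurable \<mu>" if "c \<in> ?S" for c g
    using Linf_mat_measurable[OF A] Linf_mat_measurable[OF P] that
    by (intro idempotent_defect_measurable) auto
  define B where "B = {x \<in> space \<mu>. \<exists>g. (\<forall>i. norm (g i) \<le> C) \<and> (\<forall>c\<in>?S. ?d c x g = 0)}"
  have B_iff: "x \<in> B \<longleftrightarrow> (\<exists>g. (\<forall>i. norm (g i) \<le> C) \<and>
      separated_subidempotent n (A x) (P k x) e (mat n n g))" for x
    unfolding B_def idempotent_defect_zero_iff[OF n cA cP] using space by simp
  have "B \<in> sets (completion \<nu>)"
    unfolding B_def \<mu>[symmetric]
    by (rule measurable_exists_common_zero) (use meas idempotent_defect_continuous in auto)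
  \<comment> \<open>\<open>B\<close> is measurable only for the completion, whereas the frame is
    localised to Borel subsets of \<Lambda>. Hence \<open>B\<close> is replaced by a Borel set that
    differs from it by a null set.\<close>
  then obtain S N N' where SN: "B = S \<union> N" "N \<subseteq> N'" "N' \<in> null_sets \<nu>" "S \<in> sets \<nu>"
    by (rule sets_completionE)
  define E where "E = S \<inter> \<Lambda>"
  have E: "E \<in> sets borel" "E \<subseteq> \<Lambda>" "E \<subseteq> B"
    using SN sets \<Lambda> borel_closed[OF compact_imp_closed[OF \<Lambda>]] by (auto simp: E_def)
  have E\<mu>: "E \<inter> space \<mu> \<in> sets \<mu>" using E(1) sets space by (simp add: \<mu>)
  define M where "M = restrict_space \<mu> E"
  have spaceM: "space M = E" using space by (simp add: M_def space_restrict_space)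
  have restr: "f \<in> borel_measurable M" if "f \<in> borel_measurable \<mu>" for f :: "complex \<Rightarrow> complex"
    unfolding M_def by (rule measurable_restrict_space1[OF that])
  have AE_M: "AE x in M. Q x" if "AE x in \<mu>. Q x" for Q
    using that unfolding M_def AE_restrict_space_iff[OF E\<mu>] by eventually_elim simp
  \<comment> \<open>\<open>C\<close> is arbitrary, but it bounds norms as soon as one witness
    exists.\<close>
  have C: "0 \<le> C" if "x \<in> B" for x using that unfolding B_def by (auto intro: order_trans[OF norm_ge_zero])
  have "AE x in M. False"
  proof (cases "E = {}")
    case True
    then show ?thesis using spaceM by (intro AE_I2) auto
  next
    case False
    then have C: "0 \<le> C" using C E(3) by blast
    obtain s where s: "\<And>i. (\<lambda>x. s x i) \<in> borel_measurable M"
      "AE x in M. \<exists>g. (\<forall>i. norm (g i) \<le> C) \<and> (\<forall>c\<in>?S. ?d c x g = 0) \<and>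
        (\<forall>i\<in>{..<n} \<times> {..<n}. g i = s x i)"
    proof (rule measurable_common_zero_selection[where S = ?S and M = M and F = ?d and C = C and I = "{..<n} \<times> {..<n}"])
      show "AE x in M. \<exists>g. (\<forall>i. norm (g i) \<le> C) \<and> (\<forall>c\<in>?S. ?d c x g = 0)"
        using E(3) spaceM by (intro AE_I2) (auto simp: B_def)
    qed (use C restr[OF meas] idempotent_defect_continuous in auto)
    define Q where "Q x = mat n n (s x)" for x
    have Qx: "AE x in M. (\<forall>i<n. \<forall>j<n. norm (Q x $$ (i, j)) \<le> C) \<and>
      separated_subidempotent n (A x) (P k x) e (Q x)"
      using s(2)
    proof eventually_elim
      case (elim x)
      then obtain g where g: "\<forall>i. norm (g i) \<le> C" "\<forall>c\<in>?S. ?d c x g = 0"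
        "\<forall>i\<in>{..<n} \<times> {..<n}. g i = s x i" by blast
      have Qg: "Q x = mat n n g" unfolding Q_def using g(3) by (intro eq_matI) auto
      have Q_bound: "\<forall>i<n. \<forall>j<n. norm (Q x $$ (i, j)) \<le> C" using g(1) by (simp add: Qg)
      show ?case
        using idempotent_defect_zero_iff[OF n cA[of x] cP[of x], of e g] g(1,2) Q_bound by (auto simp: Qg)
    qed
    have "(\<lambda>x. Q x $$ (i, j)) \<in> Linf M" if "i < n" "j < n" for i j
    proof -
      have "AE x in M. norm (Q x $$ (i, j)) \<le> C" using Qx by eventually_elim (use that in blast)
      moreover have "(\<lambda>x. Q x $$ (i, j)) \<in> borel_measurable M" using s(1) that by (simp add: Q_def)
      ultimately show ?thesis unfolding Linf_def by blast
    qed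
    then have "Q \<in> Linf_mat M n" by (simp add: Linf_mat_def Q_def)
    moreover have "AE x in M. A x * Q x = Q x * A x" "AE x in M. Q x * Q x = Q x"
      "AE x in M. Q x * P k x = Q x" "AE x in M. P k x * Q x = Q x"
      using Qx by (auto elim!: eventually_mono simp: separated_subidempotent_def)
    moreover have "AE x in M. Q x \<noteq> 0\<^sub>m n n"
      using Qx
    proof eventually_elim
      case (elim x)
      then show ?case using e by (auto simp: separated_subidempotent_def)
    qed
    moreover have "AE x in M. Q x * P k x = P k x * Q x"
      using Qx by eventually_elim (metis separated_subidempotent_def)
    ultimately have "Q \<in> {Q \<in> commuting_idempotents M n A (P k).
        AE x in M. x \<in> mat_support M n (P k) \<longrightarrow> Q x \<noteq> 0\<^sub>m n n}" and "idem_le M Q (P k)"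
      unfolding commuting_idempotents_def rel_commutant_def idempotent_on_def idem_le_def
      by (auto elim: eventually_mono)
    moreover have "frame_items M n A m P"
      using frame E(1,2) unfolding finite_frame_def M_def by blast
    \<comment> \<open>Equality with \<open>P k\<close> contradicts the separation by
      \<open>e\<close>, so \<open>E\<close> must be null.\<close>
    ultimately have "AE x in M. Q x = P k x"
      using k unfolding frame_items_def minimal_in_def by blast
    then show ?thesis
      using Qx
    proof eventually_elim
      case (elim x)
      then show ?case using e by (auto simp: separated_subidempotent_def)
    qed
  qed
  then have "AE x in \<mu>. x \<notin> E" unfolding M_def AE_restrict_space_iff[OF E\<mu>] by simp
  moreover have "AE x in \<mu>. x \<in> \<Lambda>" unfolding \<mu> by (rule AE_completion_in_support[OF reg])
  moreover have "AE x in \<mu>. x \<notin> N'"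
    unfolding \<mu> by (intro AE_completion AE_not_in SN(3))
  ultimately show ?thesis
  proof eventually_elim
    case (elim x)
    then have "x \<notin> B" using SN(1,2) by (auto simp: E_def)
    then show ?case unfolding B_iff .
  qed
qed

text \<open>Any nontrivial \<open>Q\<close> at a point is bounded by \<open>c\<close> and separated
  by \<open>1 / Suc c\<close> for some natural number \<open>c\<close>, so a countable union of null
  sets covers all exceptional points.\<close>

lemma AE_frame_element_indecomposable:
  fixes P :: "nat \<Rightarrow> complex \<Rightarrow> complex mat"
  assumes reg: "finite_regular_borel_on \<Lambda> \<nu>" and \<mu>: "\<mu> = completion \<nu>" and n: "0 < n"
    and A: "A \<in> Linf_mat \<mu> n" and frame: "finite_frame \<Lambda> \<mu> n A m P" and k: "k < m"
  shows "AE x in \<mu>. \<forall>Q\<in>carrier_mat n n. Q * Q = Q \<longrightarrow> A x * Q = Q * A x \<longrightarrow>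
    Q * P k x = Q \<longrightarrow> P k x * Q = Q \<longrightarrow> Q = 0\<^sub>m n n \<or> Q = P k x"
proof -
  have P: "P k \<in> Linf_mat \<mu> n" using frame k by (auto simp: finite_frame_def rel_commutant_def)
  have "AE x in \<mu>. \<forall>c::nat. \<not> (\<exists>g. (\<forall>i. norm (g i) \<le> real c) \<and>
    separated_subidempotent n (A x) (P k x) (1 / Suc c) (mat n n g))"
    unfolding AE_all_countable using AE_no_separated_subidempotent[OF assms] by simp
  then show ?thesis
    using AE_space
  proof eventually_elim
    case (elim x)
    show ?case
    proof (intro ballI impI, rule ccontr)
      fix Q assume Q: "Q \<in> carrier_mat n n" "Q * Q = Q" "A x * Q = Q * A x"
        "Q * P k x = Q" "P k x * Q = Q" and ne: "\<not> (Q = 0\<^sub>m n n \<or> Q = P k x)"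
      have R: "P k x \<in> carrier_mat n n" by (rule Linf_mat_carrier[OF P elim(2)])
      have pos: "0 < (\<Sum>a<n. \<Sum>b<n. norm (Q $$ (a, b) - D $$ (a, b)))"
        if D: "D \<in> carrier_mat n n" "Q \<noteq> D" for D
      proof -
        obtain a b where ab: "a < n" "b < n" "Q $$ (a, b) \<noteq> D $$ (a, b)"
          using D(2) mat_eq_iff_entries[OF Q(1) D(1)] by blast
        then have "0 < norm (Q $$ (a, b) - D $$ (a, b))" by simp
        also have "\<dots> \<le> (\<Sum>b<n. norm (Q $$ (a, b) - D $$ (a, b)))"
          using ab by (intro member_le_sum) auto
        also have "\<dots> \<le> (\<Sum>a<n. \<Sum>b<n. norm (Q $$ (a, b) - D $$ (a, b)))"
          using ab member_le_sum[of a "{..<n}" "\<lambda>a. \<Sum>b<n. norm (Q $$ (a, b) - D $$ (a, b))"]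
          by (auto simp: sum_nonneg)
        finally show ?thesis .
      qed
      let ?q = "\<Sum>a<n. \<Sum>b<n. norm (Q $$ (a, b))"
      let ?p = "\<Sum>a<n. \<Sum>b<n. norm (Q $$ (a, b) - P k x $$ (a, b))"
      have q: "0 < ?q" using pos[of "0\<^sub>m n n"] ne by simp
      have p: "0 < ?p" using pos[OF R] ne by simp
      \<comment> \<open>Large enough to dominate every entry of \<open>Q\<close> through
        \<open>?q\<close>, and to put \<open>1 / Suc c\<close> below the distances \<open>?q\<close>
        to 0 and \<open>?p\<close> to \<open>P k x\<close>.\<close>
      define c where "c = nat \<lceil>max ?q (max (1 / ?q) (1 / ?p))\<rceil>"
      have c: "max ?q (max (1 / ?q) (1 / ?p)) \<le> real c" unfolding c_def by (rule real_nat_ceiling_ge)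
      then have "1 / ?q \<le> Suc c" "1 / ?p \<le> Suc c" by auto
      then have small: "1 / Suc c \<le> ?q" "1 / Suc c \<le> ?p"
        using p q by (auto simp: field_simps)
      define g where "g = (\<lambda>(i, j). if i < n \<and> j < n then Q $$ (i, j) else 0)"
      have Qg: "mat n n g = Q" using Q(1) by (intro eq_matI) (auto simp: g_def)
      have "norm (g i) \<le> real c" for i
      proof (cases i)
        case (Pair a b)
        show ?thesis
        proof (cases "a < n \<and> b < n")
          case True
          then have "norm (Q $$ (a, b)) \<le> (\<Sum>b<n. norm (Q $$ (a, b)))"
            by (intro member_le_sum) auto
          also have "\<dots> \<le> ?q"
            using True member_le_sum[of a "{..<n}" "\<lambda>a. \<Sum>b<n. norm (Q $$ (a, b))"]
            by (auto simp: sum_nonneg)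
          finally show ?thesis using c Pair True by (simp add: g_def)
        next
          case False
          then show ?thesis by (auto simp: Pair g_def)
        qed
      qed
      moreover have "separated_subidempotent n (A x) (P k x) (1 / Suc c) (mat n n g)"
        unfolding Qg separated_subidempotent_def using Q(2-) small by auto
      ultimately show False using elim(1) by blast
    qed
  qed
qed

subsection \<open>Measurable triangularization of one block\<close>

text \<open>With \<open>X * Y = 1\<^sub>m r\<close> and \<open>Y * X = P\<close> this identifies the
  trace of an idempotent with its rank \<open>r\<close>.\<close>

lemma mat_trace_mult_commute:
  assumes "X \<in> carrier_mat r n" "Y \<in> carrier_mat n r"
  shows "mat_trace (X * Y) = mat_trace (Y * X)"
proof -
  have "mat_trace (X * Y) = (\<Sum>i<r. \<Sum>l<n. X $$ (i, l) * Y $$ (l, i))"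
    using assms by (simp add: mat_trace_def scalar_prod_def atLeast0LessThan)
  also have "\<dots> = (\<Sum>l<n. \<Sum>i<r. Y $$ (l, i) * X $$ (i, l))"
    by (subst sum.swap) (simp add: mult.commute)
  also have "\<dots> = mat_trace (Y * X)"
    using assms by (simp add: mat_trace_def scalar_prod_def atLeast0LessThan)
  finally show ?thesis .
qed

lemma mat_trace_one: "mat_trace (1\<^sub>m r) = of_nat r"
  by (simp add: mat_trace_def)

text \<open>A rank factorisation of the idempotent \<open>R\<close>: the columns of \<open>Y\<close>
  are a basis of its range and \<open>X\<close> gives the coordinates, so \<open>X * A * Y\<close>
  is the matrix of the compression of \<open>A\<close>.\<close>

definition triangularizes ::
  "nat \<Rightarrow> nat \<Rightarrow> complex mat \<Rightarrow> complex mat \<Rightarrow> complex mat \<Rightarrow> complex mat \<Rightarrow> bool" where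
  "triangularizes n r A R X Y \<longleftrightarrow> X \<in> carrier_mat r n \<and> Y \<in> carrier_mat n r \<and>
    X * Y = 1\<^sub>m r \<and> Y * X = R \<and> upper_triangular (X * A * Y)"

text \<open>
  A pair \<open>(X, Y)\<close> is encoded as one function \<open>g\<close>, with \<open>X\<close> at the indices \<open>(False, i, j)\<close> and \<open>Y\<close> at
  \<open>(True, i, j)\<close>.
\<close>

definition triangularization_defect ::
  "nat \<Rightarrow> nat \<Rightarrow> complex mat \<Rightarrow> complex mat \<Rightarrow> nat \<times> nat \<times> nat \<Rightarrow> (bool \<times> nat \<times> nat \<Rightarrow> complex) \<Rightarrow> complex"
where
  "triangularization_defect n r A R = (\<lambda>(t, i, j) g.
    if t = 0 then (\<Sum>l<n. g (False, i, l) * g (True, l, j)) - (if i = j then 1 else 0)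
    else if t = 1 then (\<Sum>l<r. g (True, i, l) * g (False, l, j)) - R $$ (i, j)
    else (\<Sum>l<n. (\<Sum>p<n. g (False, i, p) * A $$ (p, l)) * g (True, l, j)))"

definition triangularization_indices :: "nat \<Rightarrow> nat \<Rightarrow> (nat \<times> nat \<times> nat) set" where
  "triangularization_indices n r =
    {0} \<times> {..<r} \<times> {..<r} \<union> {1} \<times> {..<n} \<times> {..<n} \<union> {2} \<times> {(i, j). j < i \<and> i < r}"

lemma finite_triangularization_indices: "finite (triangularization_indices n r)"
proof -
  have "{(i, j). j < i \<and> i < r} \<subseteq> {..<r} \<times> {..<r}" by auto
  then have "finite {(i, j). j < i \<and> i < r}" by (rule finite_subset) simp
  then show ?thesis by (simp add: triangularization_indices_def)
qed

lemma triangularization_defect_zero_iff: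
  assumes A: "A \<in> carrier_mat n n" and R: "R \<in> carrier_mat n n"
  shows "(\<forall>c\<in>triangularization_indices n r. triangularization_defect n r A R c g = 0) \<longleftrightarrow>
    triangularizes n r A R (mat r n (\<lambda>ij. g (False, ij))) (mat n r (\<lambda>ij. g (True, ij)))"
proof -
  let ?X = "mat r n (\<lambda>ij. g (False, ij))" and ?Y = "mat n r (\<lambda>ij. g (True, ij))"
  let ?d = "triangularization_defect n r A R"
  have X: "?X \<in> carrier_mat r n" and Y: "?Y \<in> carrier_mat n r" by simp_all
  have XA: "?X * A \<in> carrier_mat r n" by (rule mult_carrier_mat[OF X A])
  have "(\<forall>c\<in>triangularization_indices n r. ?d c g = 0) \<longleftrightarrow>
     (\<forall>i<r. \<forall>j<r. ?d (0, i, j) g = 0) \<and> (\<forall>i<n. \<forall>j<n. ?d (1, i, j) g = 0) \<and>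
     (\<forall>j i. j < i \<longrightarrow> i < r \<longrightarrow> ?d (2, i, j) g = 0)"
    unfolding triangularization_indices_def by blast
  also have "(\<forall>i<r. \<forall>j<r. ?d (0, i, j) g = 0) = (?X * ?Y = 1\<^sub>m r)"
    unfolding mat_eq_iff_entries[OF mult_carrier_mat[OF X Y] one_carrier_mat]
    by (simp add: mult_entry[OF X Y] triangularization_defect_def del: index_mult_mat(1))
  also have "(\<forall>i<n. \<forall>j<n. ?d (1, i, j) g = 0) = (?Y * ?X = R)"
    unfolding mat_eq_iff_entries[OF mult_carrier_mat[OF Y X] R]
    by (simp add: mult_entry[OF Y X] triangularization_defect_def del: index_mult_mat(1))
  also have "(\<forall>j i. j < i \<longrightarrow> i < r \<longrightarrow> ?d (2, i, j) g = 0) = upper_triangular (?X * A * ?Y)"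
    unfolding upper_triangular_def
    by (auto simp: mult_entry[OF XA Y] mult_entry[OF X A] triangularization_defect_def
        simp del: index_mult_mat(1))
  finally show ?thesis unfolding triangularizes_def by simp
qed

lemma triangularization_defect_continuous:
  "continuous_on UNIV (triangularization_defect n r A R c)"
proof -
  obtain t i j where c: "c = (t, i, j)" by (cases c)
  consider "t = 0" | "t = 1" | "t \<noteq> 0" "t \<noteq> 1" by blast
  then show ?thesis unfolding c triangularization_defect_def prod.case
    by cases (auto intro!: continuous_intros continuous_on_product_coordinates)
qed

lemma triangularization_defect_measurable:
  assumes A: "\<And>i j. i < n \<Longrightarrow> j < n \<Longrightarrow> (\<lambda>x. A x $$ (i, j)) \<in> borel_measurable M"
    and R: "\<And>i j. i < n \<Longrightarrow> j < n \<Longrightarrow> (\<lambda>x. R x $$ (i, j)) \<in> borel_measurable M"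
    and c: "c \<in> triangularization_indices n r"
  shows "(\<lambda>x. triangularization_defect n r (A x) (R x) c g) \<in> borel_measurable M"
proof -
  obtain t i j where tij: "c = (t, i, j)" by (cases c)
  have m2: "(\<lambda>x. \<Sum>l<n. (\<Sum>p<n. g (False, i, p) * A x $$ (p, l)) * g (True, l, j))
      \<in> borel_measurable M"
    by (intro borel_measurable_sum borel_measurable_times borel_measurable_const A) auto
  have m1: "(\<lambda>x. R x $$ (i, j)) \<in> borel_measurable M" if "t = 1"
    using c that by (intro R) (auto simp: tij triangularization_indices_def)
  consider "t = 0" | "t = 1" | "t \<noteq> 0" "t \<noteq> 1" by blast
  then show ?thesis
  proof cases
    case 2
    then show ?thesis using m1 by (simp add: tij triangularization_defect_def)
  next
    case 3
    then show ?thesis using m2 by (simp add: tij triangularization_defect_def)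
  qed (simp add: tij triangularization_defect_def)
qed

text \<open>The pointwise factorisation has size \<open>r'\<close> equal to the rank of
  \<open>R x\<close>; the trace hypothesis forces \<open>r' = r\<close>, so all pairs live in one
  polydisc. Its radius also bounds the selected entries, which puts them in
  \<open>Linf\<close>.\<close>

lemma measurable_triangularization:
  assumes A: "A \<in> Linf_mat M n" and R: "R \<in> Linf_mat M n"
    and idem: "AE x in M. R x * R x = R x" and comm: "AE x in M. A x * R x = R x * A x"
    and tr: "AE x in M. mat_trace (R x) = of_nat r"
  obtains X Y where "\<And>x. X x \<in> carrier_mat r n" "\<And>x. Y x \<in> carrier_mat n r"
    "\<And>i j. i < r \<Longrightarrow> j < n \<Longrightarrow> (\<lambda>x. X x $$ (i, j)) \<in> Linf M"
    "\<And>i j. i < n \<Longrightarrow> j < r \<Longrightarrow> (\<lambda>x. Y x $$ (i, j)) \<in> Linf M"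
    "AE x in M. triangularizes n r (A x) (R x) (X x) (Y x)"
proof -
  obtain C where C: "0 \<le> C" "AE x in M. \<forall>i<n. \<forall>j<n. norm (R x $$ (i, j)) \<le> C"
    by (rule Linf_mat_bounded[OF R])
  \<comment> \<open>A common radius: 1 for the orthonormal columns of \<open>Y\<close>,
    \<open>n * C\<close> for the dual coordinates \<open>X\<close>.\<close>
  define K where "K = max 1 (n * C)"
  let ?d = "\<lambda>c x. triangularization_defect n r (A x) (R x) c"
  let ?S = "triangularization_indices n r"
  let ?I = "{False} \<times> {..<r} \<times> {..<n} \<union> {True} \<times> {..<n} \<times> {..<r}"
  let ?X = "\<lambda>g. mat r n (\<lambda>ij. g (False, ij))" and ?Y = "\<lambda>g. mat n r (\<lambda>ij. g (True, ij))"
  have zero: "AE x in M. \<exists>g. (\<forall>i. norm (g i) \<le> K) \<and> (\<forall>c\<in>?S. ?d c x g = 0)"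
    using C(2) idem comm tr AE_space
  proof eventually_elim
    case (elim x)
    have Ax: "A x \<in> carrier_mat n n" and Rx: "R x \<in> carrier_mat n n"
      using Linf_mat_carrier[OF A elim(5)] Linf_mat_carrier[OF R elim(5)] by auto
    obtain r' X Y where XY: "X \<in> carrier_mat r' n" "Y \<in> carrier_mat n r'"
      "X * Y = 1\<^sub>m r'" "Y * X = R x" "upper_triangular (X * A x * Y)"
      "\<And>i j. i < n \<Longrightarrow> j < r' \<Longrightarrow> norm (Y $$ (i, j)) \<le> 1"
      "\<And>i j. i < r' \<Longrightarrow> j < n \<Longrightarrow> norm (X $$ (i, j)) \<le> n * C"
      by (rule bounded_triangularization_of_range[OF Ax Rx elim(2,3), of C]) (use elim(1) in auto)
    have "(of_nat r' :: complex) = of_nat r"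
      using mat_trace_mult_commute[OF XY(1,2)] elim(4) XY(3,4) by (simp add: mat_trace_one)
    then have r': "r' = r" by simp
    \<comment> \<open>Padding by 0 keeps the bound at the indices outside both matrices.\<close>
    define g where "g = (\<lambda>(b, i, j). if b then if i < n \<and> j < r then Y $$ (i, j) else 0
      else if i < r \<and> j < n then X $$ (i, j) else 0)"
    have "?X g = X" "?Y g = Y" using XY(1,2) r' by (auto intro!: eq_matI simp: g_def)
    then have "triangularizes n r (A x) (R x) (?X g) (?Y g)"
      using XY(1-5) r' by (simp add: triangularizes_def)
    moreover have "norm (g i) \<le> K" for i
    proof -
      obtain b a c where i: "i = (b, a, c)" by (cases i)
      show ?thesis
        using XY(6)[of a c] XY(7)[of a c] r' unfolding i g_def K_def by (auto simp: max_def)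
    qed
    ultimately show ?case using triangularization_defect_zero_iff[OF Ax Rx, of r g] by blast
  qed
  obtain s where s: "\<And>i. (\<lambda>x. s x i) \<in> borel_measurable M"
    "AE x in M. \<exists>g. (\<forall>i. norm (g i) \<le> K) \<and> (\<forall>c\<in>?S. ?d c x g = 0) \<and> (\<forall>i\<in>?I. g i = s x i)"
  proof (rule measurable_common_zero_selection[where S = ?S and M = M and F = ?d and C = K and I = ?I])
    show "(\<lambda>x. ?d c x g) \<in> borel_measurable M" if "c \<in> ?S" for c g
      using triangularization_defect_measurable[OF Linf_mat_measurable[OF A] Linf_mat_measurable[OF R] that] .
    show "0 \<le> K" by (simp add: K_def)
  qed (use zero finite_triangularization_indices triangularization_defect_continuous in auto)
  have good: "AE x in M. (\<forall>i\<in>?I. norm (s x i) \<le> K) \<and>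
    triangularizes n r (A x) (R x) (?X (s x)) (?Y (s x))"
    using s(2) AE_space
  proof eventually_elim
    case (elim x)
    then obtain g where g: "\<forall>i. norm (g i) \<le> K" "\<forall>c\<in>?S. ?d c x g = 0" "\<forall>i\<in>?I. g i = s x i"
      by blast
    \<comment> \<open>Both matrices read only coordinates in \<open>?I\<close>, where
      \<open>s x\<close> and the solution \<open>g\<close> agree.\<close>
    have "?X (s x) = ?X g" "?Y (s x) = ?Y g" using g(3) by (auto intro!: eq_matI)
    moreover have "\<forall>i\<in>?I. norm (s x i) \<le> K" using g(1,3) by metis
    ultimately show ?case
      using triangularization_defect_zero_iff[OF Linf_mat_carrier[OF A elim(2)]
          Linf_mat_carrier[OF R elim(2)], of r g] g(2) by simp
  qed
  have Linf_s: "(\<lambda>x. s x i) \<in> Linf M" if "i \<in> ?I" for i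
  proof -
    have "AE x in M. norm (s x i) \<le> K" using good by eventually_elim (use that in blast)
    then show ?thesis using s(1) unfolding Linf_def by blast
  qed
  show thesis
  proof (rule that[of "\<lambda>x. ?X (s x)" "\<lambda>x. ?Y (s x)"])
    show "AE x in M. triangularizes n r (A x) (R x) (?X (s x)) (?Y (s x))"
      using good by eventually_elim blast
  qed (use Linf_s in simp_all)
qed

text \<open>The map from \<open>q\<close> to \<open>Y * (q * X)\<close> carries idempotents
  commuting with the compression to idempotents below \<open>R\<close> commuting with
  \<open>A\<close>, and it is inverted by \<open>X * Q * Y\<close>. It sends 0 to 0 and 1 to
  \<open>R\<close>, so indecomposability passes to the compression.\<close>

lemma triangularizes_indecomposable:
  assumes A: "A \<in> carrier_mat n n" and comm: "A * R = R * A"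
    and tri: "triangularizes n r A R X Y"
    and indec: "\<forall>Q\<in>carrier_mat n n. Q * Q = Q \<longrightarrow> A * Q = Q * A \<longrightarrow> Q * R = Q \<longrightarrow> R * Q = Q \<longrightarrow>
      Q = 0\<^sub>m n n \<or> Q = R"
  shows "\<And>j. j < r \<Longrightarrow> (X * A * Y) $$ (j, j) = (X * A * Y) $$ (0, 0)"
    and "\<And>j. Suc j < r \<Longrightarrow> (X * A * Y) $$ (j, Suc j) \<noteq> 0"
proof -
  have X: "X \<in> carrier_mat r n" and Y: "Y \<in> carrier_mat n r" and XY: "X * Y = 1\<^sub>m r"
    and YX: "Y * X = R" and ut: "upper_triangular (X * A * Y)"
    using tri by (auto simp: triangularizes_def)
  define T where "T = X * A * Y"
  have T: "T \<in> carrier_mat r r" using X A Y by (simp add: T_def)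
  have R: "R \<in> carrier_mat n n" using X Y YX by auto
  have XYX: "X * (Y * M) = M" if "M \<in> carrier_mat r k" for M k
    using assoc_mult_mat[OF X Y that] XY that by simp
  have TX: "T * X = X * A"
  proof -
    have XA: "X * A \<in> carrier_mat r n" using X A by simp
    have "T * X = X * A * R" unfolding T_def using assoc_mult_mat[OF XA Y X] YX by simp
    also have "\<dots> = X * (R * A)" using assoc_mult_mat[OF X A R] comm by simp
    also have "\<dots> = X * (Y * (X * A))" using assoc_mult_mat[OF Y X A] YX by simp
    finally show ?thesis using XYX[OF XA] by simp
  qed
  have YT: "Y * T = A * Y"
  proof -
    have AY: "A * Y \<in> carrier_mat n r" using A Y by simp
    have "Y * T = Y * (X * (A * Y))" unfolding T_def using assoc_mult_mat[OF X A Y] by simp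
    also have "\<dots> = R * (A * Y)" using assoc_mult_mat[OF Y X AY] YX by simp
    also have "\<dots> = A * R * Y" using assoc_mult_mat[OF R A Y] comm by simp
    also have "\<dots> = A * (R * Y)" by (rule assoc_mult_mat[OF A R Y])
    also have "R * Y = Y" using assoc_mult_mat[OF Y X Y] YX XY Y by simp
    finally show ?thesis .
  qed
  have indecT: "q = 0\<^sub>m r r \<or> q = 1\<^sub>m r"
    if q: "q \<in> carrier_mat r r" "q * q = q" "T * q = q * T" for q
  proof -
    define Q where "Q = Y * (q * X)"
    have qX: "q * X \<in> carrier_mat r n" using q X by simp
    have Q: "Q \<in> carrier_mat n n" using Y qX by (simp add: Q_def)
    have XQ: "X * Q = q * X" unfolding Q_def by (rule XYX[OF qX])
    have "Q * Q = Y * (q * X * Q)" unfolding Q_def by (rule assoc_mult_mat[OF Y qX Q[unfolded Q_def]])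
    also have "q * X * Q = q * (q * X)" using assoc_mult_mat[OF q(1) X Q] XQ by simp
    also have "\<dots> = q * X" using assoc_mult_mat[OF q(1) q(1) X] q(2) by simp
    finally have QQ: "Q * Q = Q" by (simp add: Q_def)
    have "A * Q = A * Y * (q * X)" unfolding Q_def by (rule assoc_mult_mat[OF A Y qX, symmetric])
    also have "\<dots> = Y * (T * (q * X))" unfolding YT[symmetric] by (rule assoc_mult_mat[OF Y T qX])
    also have "T * (q * X) = q * (T * X)"
      using assoc_mult_mat[OF T q(1) X] assoc_mult_mat[OF q(1) T X] q(3) by simp
    also have "q * (T * X) = q * X * A" unfolding TX by (rule assoc_mult_mat[OF q(1) X A, symmetric])
    also have "Y * (q * X * A) = Q * A" unfolding Q_def by (rule assoc_mult_mat[OF Y qX A, symmetric])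
    finally have AQ: "A * Q = Q * A" .
    have RQ: "R * Q = Q" using assoc_mult_mat[OF Y X Q] XQ by (simp add: YX Q_def)
    have XR: "X * R = X" using assoc_mult_mat[OF X Y X] XY X by (simp add: YX)
    have "Q * R = Y * (q * X * R)" unfolding Q_def by (rule assoc_mult_mat[OF Y qX R])
    also have "q * X * R = q * X" using assoc_mult_mat[OF q(1) X R] XR by simp
    finally have QR: "Q * R = Q" by (simp add: Q_def)
    have qQ: "q = X * Q * Y"
      unfolding XQ using assoc_mult_mat[OF q(1) X Y] XY q(1) by simp
    show ?thesis
    proof (cases "Q = 0\<^sub>m n n")
      case True
      then show ?thesis using qQ X Y by simp
    next
      case False
      then have "Q = R" using indec Q QQ AQ QR RQ by blast
      then show ?thesis using qQ XR XY by simp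
    qed
  qed
  note * = indecomposable_upper_triangular[OF T ut[folded T_def] indecT]
  show "(X * A * Y) $$ (j, j) = (X * A * Y) $$ (0, 0)" if "j < r" for j
    using *(1)[OF _ _ _ that] by (simp add: T_def)
  show "(X * A * Y) $$ (j, Suc j) \<noteq> 0" if "Suc j < r" for j
    using *(2)[OF _ _ _ that] by (simp add: T_def)
qed

subsection \<open>Assembling the blocks\<close>

primrec stack_rows :: "nat \<Rightarrow> nat \<Rightarrow> (nat \<Rightarrow> 'a::zero mat) \<Rightarrow> 'a mat" where
  "stack_rows n 0 X = 0\<^sub>m 0 n"
| "stack_rows n (Suc m) X = stack_rows n m X @\<^sub>r X m"

primrec stack_cols :: "nat \<Rightarrow> nat \<Rightarrow> (nat \<Rightarrow> 'a::zero mat) \<Rightarrow> 'a mat" where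
  "stack_cols n 0 Y = 0\<^sub>m n 0"
| "stack_cols n (Suc m) Y = stack_cols n m Y @\<^sub>c Y m"

lemma stack_rows_carrier:
  "(\<And>k. k < m \<Longrightarrow> X k \<in> carrier_mat (ns k) n) \<Longrightarrow> stack_rows n m X \<in> carrier_mat (\<Sum>k<m. ns k) n"
  by (induction m) auto

lemma stack_cols_carrier:
  "(\<And>k. k < m \<Longrightarrow> Y k \<in> carrier_mat n (ns k)) \<Longrightarrow> stack_cols n m Y \<in> carrier_mat n (\<Sum>k<m. ns k)"
  by (induction m) auto

lemma stack_rows_mult_zero:
  fixes X :: "nat \<Rightarrow> 'a::semiring_0 mat"
  assumes "\<And>k. k < m \<Longrightarrow> X k \<in> carrier_mat (ns k) n" "\<And>k. k < m \<Longrightarrow> X k * M = 0\<^sub>m (ns k) p"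
    and M: "M \<in> carrier_mat n p"
  shows "stack_rows n m X * M = 0\<^sub>m (\<Sum>k<m. ns k) p"
  using assms(1,2)
proof (induction m)
  case 0
  then show ?case using M by auto
next
  case (Suc m)
  have "stack_rows n (Suc m) X * M = (stack_rows n m X * M) @\<^sub>r (X m * M)"
    unfolding stack_rows.simps
    by (rule append_rows_mult[OF stack_rows_carrier[where ns = ns] _ M]) (use Suc.prems in auto)
  also have "\<dots> = 0\<^sub>m (\<Sum>k<m. ns k) p @\<^sub>r 0\<^sub>m (ns m) p" using Suc by simp
  also have "\<dots> = 0\<^sub>m (\<Sum>k<Suc m. ns k) p" by (intro eq_matI) (auto simp: append_rows_def)
  finally show ?case .
qed

lemma mult_stack_cols_zero:
  fixes Y :: "nat \<Rightarrow> 'a::semiring_0 mat"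
  assumes "\<And>k. k < m \<Longrightarrow> Y k \<in> carrier_mat n (ns k)" "\<And>k. k < m \<Longrightarrow> M * Y k = 0\<^sub>m p (ns k)"
    and M: "M \<in> carrier_mat p n"
  shows "M * stack_cols n m Y = 0\<^sub>m p (\<Sum>k<m. ns k)"
  using assms(1,2)
proof (induction m)
  case 0
  then show ?case using M by auto
next
  case (Suc m)
  have "M * stack_cols n (Suc m) Y = (M * stack_cols n m Y) @\<^sub>c (M * Y m)"
    unfolding stack_cols.simps
    by (rule mult_append_cols[OF stack_cols_carrier[where ns = ns] _ M]) (use Suc.prems in auto)
  also have "\<dots> = 0\<^sub>m p (\<Sum>k<m. ns k) @\<^sub>c 0\<^sub>m p (ns m)" using Suc by simp
  also have "\<dots> = 0\<^sub>m p (\<Sum>k<Suc m. ns k)" by (intro eq_matI) (auto simp: append_cols_def)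
  finally show ?case .
qed

text \<open>For a frame the right-hand side is the sum of the \<open>P k x\<close>, that is, the
  identity; this is why the stacked coordinate matrices are inverse to each other.\<close>

lemma stack_cols_mult_stack_rows:
  fixes X Y :: "nat \<Rightarrow> 'a::semiring_0 mat"
  assumes "\<And>k. k < m \<Longrightarrow> X k \<in> carrier_mat (ns k) n" "\<And>k. k < m \<Longrightarrow> Y k \<in> carrier_mat n (ns k)"
  shows "stack_cols n m Y * stack_rows n m X = mat n n (\<lambda>(i, j). \<Sum>k<m. (Y k * X k) $$ (i, j))"
  using assms
proof (induction m)
  case 0
  then show ?case by (intro eq_matI) (auto simp: scalar_prod_def)
next
  case (Suc m)
  have "stack_cols n (Suc m) Y * stack_rows n (Suc m) X
    = stack_cols n m Y * stack_rows n m X + Y m * X m"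
    unfolding stack_cols.simps stack_rows.simps
    by (rule append_cols_mult_append_rows[OF stack_cols_carrier[where ns = ns] _ stack_rows_carrier[where ns = ns]])
      (use Suc.prems in auto)
  also have "stack_cols n m Y * stack_rows n m X = mat n n (\<lambda>(i, j). \<Sum>k<m. (Y k * X k) $$ (i, j))"
    by (rule Suc.IH) (use Suc.prems in auto)
  also have "\<dots> + Y m * X m = mat n n (\<lambda>(i, j). \<Sum>k<Suc m. (Y k * X k) $$ (i, j))"
    using Suc.prems(1)[of m] Suc.prems(2)[of m] by (intro eq_matI) auto
  finally show ?case .
qed

text \<open>Each new block borders the previous product by the mixed terms
  \<open>X i * (A * Y m)\<close> and \<open>X m * (A * Y i)\<close>, which vanish, so the diagonal
  block matrix grows at its end.\<close>

lemma stack_rows_mult_stack_cols: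
  fixes X Y :: "nat \<Rightarrow> 'a::semiring_0 mat"
  assumes A: "A \<in> carrier_mat n n"
    and "\<And>k. k < m \<Longrightarrow> X k \<in> carrier_mat (ns k) n" "\<And>k. k < m \<Longrightarrow> Y k \<in> carrier_mat n (ns k)"
    and "\<And>i j. i < m \<Longrightarrow> j < m \<Longrightarrow> i \<noteq> j \<Longrightarrow> X i * (A * Y j) = 0\<^sub>m (ns i) (ns j)"
  shows "stack_rows n m X * A * stack_cols n m Y
    = diag_block_mat (map (\<lambda>k. X k * A * Y k) [0..<m])"
  using assms(2-)
proof (induction m)
  case 0
  then show ?case using A by auto
next
  case (Suc m)
  let ?R = "stack_rows n m X" and ?C = "stack_cols n m Y" and ?s = "\<Sum>k<m. ns k"
  have R: "?R \<in> carrier_mat ?s n" by (rule stack_rows_carrier) (use Suc.prems in auto)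
  have C: "?C \<in> carrier_mat n ?s" by (rule stack_cols_carrier) (use Suc.prems in auto)
  have X: "X m \<in> carrier_mat (ns m) n" and Y: "Y m \<in> carrier_mat n (ns m)" using Suc.prems by auto
  have RA: "?R * A \<in> carrier_mat ?s n" and XA: "X m * A \<in> carrier_mat (ns m) n"
    and AY: "A * Y m \<in> carrier_mat n (ns m)" using R X Y A by auto
  have "?R * A * Y m = 0\<^sub>m ?s (ns m)"
    unfolding assoc_mult_mat[OF R A Y] by (rule stack_rows_mult_zero) (use Suc.prems AY in auto)
  moreover have "X m * A * ?C = 0\<^sub>m (ns m) ?s"
  proof (rule mult_stack_cols_zero)
    show "X m * A * Y k = 0\<^sub>m (ns m) (ns k)" if "k < m" for k
      using assoc_mult_mat[OF X A Suc.prems(2)[of k]] Suc.prems(3)[of m k] that by simp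
  qed (use Suc.prems XA in auto)
  moreover have "?R * A * ?C = diag_block_mat (map (\<lambda>k. X k * A * Y k) [0..<m])"
    by (rule Suc.IH) (use Suc.prems in auto)
  moreover have "stack_rows n (Suc m) X * A * stack_cols n (Suc m) Y
    = four_block_mat (?R * A * ?C) (?R * A * Y m) (X m * A * ?C) (X m * A * Y m)"
    unfolding stack_rows.simps stack_cols.simps append_rows_mult[OF R X A]
    by (rule append_rows_mult_append_cols[OF C Y RA XA])
  moreover have "dim_row (?R * A * ?C) = ?s" "dim_col (?R * A * ?C) = ?s"
    "dim_row (X m * A * Y m) = ns m" "dim_col (X m * A * Y m) = ns m"
    using R C X Y by auto
  ultimately show ?case by (simp add: diag_block_mat_last Let_def)
qed

lemma stack_rows_Linf:
  assumes "\<And>k x. k < m \<Longrightarrow> X k x \<in> carrier_mat (ns k) n"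
    and "\<And>k i j. k < m \<Longrightarrow> i < ns k \<Longrightarrow> j < n \<Longrightarrow> (\<lambda>x. X k x $$ (i, j)) \<in> Linf M"
    and "i < (\<Sum>k<m. ns k)" "j < n"
  shows "(\<lambda>x. stack_rows n m (\<lambda>k. X k x) $$ (i, j)) \<in> Linf M"
  using assms(1-3)
proof (induction m arbitrary: i)
  case (Suc m)
  have R: "stack_rows n m (\<lambda>k. X k x) \<in> carrier_mat (\<Sum>k<m. ns k) n" for x
    by (rule stack_rows_carrier) (use Suc.prems in auto)
  have X: "X m x \<in> carrier_mat (ns m) n" for x using Suc.prems by simp
  have "stack_rows n (Suc m) (\<lambda>k. X k x) $$ (i, j) = (if i < (\<Sum>k<m. ns k)
      then stack_rows n m (\<lambda>k. X k x) $$ (i, j) else X m x $$ (i - (\<Sum>k<m. ns k), j))" for x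
    using R[of x] X[of x] Suc.prems(3) \<open>j < n\<close> by (auto simp: append_rows_def)
  moreover have "(\<lambda>x. stack_rows n m (\<lambda>k. X k x) $$ (i, j)) \<in> Linf M" if "i < (\<Sum>k<m. ns k)"
    by (rule Suc.IH) (use Suc.prems that in auto)
  moreover have "(\<lambda>x. X m x $$ (i - (\<Sum>k<m. ns k), j)) \<in> Linf M" if "\<not> i < (\<Sum>k<m. ns k)"
    by (rule Suc.prems(2)) (use Suc.prems(3) that \<open>j < n\<close> in auto)
  ultimately show ?case by (cases "i < (\<Sum>k<m. ns k)") auto
qed simp

lemma stack_cols_Linf:
  assumes "\<And>k x. k < m \<Longrightarrow> Y k x \<in> carrier_mat n (ns k)"
    and "\<And>k i j. k < m \<Longrightarrow> i < n \<Longrightarrow> j < ns k \<Longrightarrow> (\<lambda>x. Y k x $$ (i, j)) \<in> Linf M"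
    and "i < n" "j < (\<Sum>k<m. ns k)"
  shows "(\<lambda>x. stack_cols n m (\<lambda>k. Y k x) $$ (i, j)) \<in> Linf M"
  using assms(1,2,4)
proof (induction m arbitrary: j)
  case (Suc m)
  have C: "stack_cols n m (\<lambda>k. Y k x) \<in> carrier_mat n (\<Sum>k<m. ns k)" for x
    by (rule stack_cols_carrier) (use Suc.prems in auto)
  have Y: "Y m x \<in> carrier_mat n (ns m)" for x using Suc.prems by simp
  have "stack_cols n (Suc m) (\<lambda>k. Y k x) $$ (i, j) = (if j < (\<Sum>k<m. ns k)
      then stack_cols n m (\<lambda>k. Y k x) $$ (i, j) else Y m x $$ (i, j - (\<Sum>k<m. ns k)))" for x
    using C[of x] Y[of x] Suc.prems(3) \<open>i < n\<close> by (auto simp: append_cols_def)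
  moreover have "(\<lambda>x. stack_cols n m (\<lambda>k. Y k x) $$ (i, j)) \<in> Linf M" if "j < (\<Sum>k<m. ns k)"
    by (rule Suc.IH) (use Suc.prems that in auto)
  moreover have "(\<lambda>x. Y m x $$ (i, j - (\<Sum>k<m. ns k))) \<in> Linf M" if "\<not> j < (\<Sum>k<m. ns k)"
    by (rule Suc.prems(2)) (use Suc.prems(3) that \<open>i < n\<close> in auto)
  ultimately show ?case by (cases "j < (\<Sum>k<m. ns k)") auto
qed simp

text \<open>The trace of an idempotent is its rank, hence a natural number, and the traces of
  idempotents summing to the identity add up to \<open>n\<close>.\<close>

lemma exists_constant_ranks:
  assumes A: "A \<in> Linf_mat M n" and P: "\<And>k. k < m \<Longrightarrow> P k \<in> Linf_mat M n"
    and idem: "\<And>k. k < m \<Longrightarrow> AE x in M. P k x * P k x = P k x"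
    and comm: "\<And>k. k < m \<Longrightarrow> AE x in M. A x * P k x = P k x * A x"
    and sum: "AE x in M. mat n n (\<lambda>(i, j). \<Sum>k<m. P k x $$ (i, j)) = 1\<^sub>m n"
    and tr: "\<And>k. k < m \<Longrightarrow> \<exists>c. AE x in M. mat_trace (P k x) = c"
    and m: "1 \<le> m"
  obtains ns :: "nat \<Rightarrow> nat" where "(\<Sum>k<m. ns k) = n"
    "\<And>k. k < m \<Longrightarrow> AE x in M. mat_trace (P k x) = of_nat (ns k)"
proof (cases "AE x in M. False")
  case True
  show thesis
  \<comment> \<open>For the zero measure the traces carry no information, so all of \<open>n\<close>
    is put into the first block, which exists by \<open>m\<close>.\<close>
  proof (rule that[of "\<lambda>k. if k = 0 then n else 0"])
    show "(\<Sum>k<m. if k = 0 then n else 0) = n" using m by (simp add: sum.delta)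
    show "AE x in M. mat_trace (P k x) = of_nat (if k = 0 then n else 0)" for k
      using True by eventually_elim simp
  qed
next
  case False
  obtain c where c: "\<And>k. k < m \<Longrightarrow> AE x in M. mat_trace (P k x) = c k" using tr by metis
  have all: "AE x in M. \<forall>k\<in>{..<m}. P k x * P k x = P k x \<and> A x * P k x = P k x * A x \<and> mat_trace (P k x) = c k"
    using idem comm c by (intro AE_finite_allI) auto
  \<comment> \<open>The claim inside does not mention \<open>x\<close>, so one point where it holds
    is enough.\<close>
  have "AE x in M. \<exists>ns. (\<Sum>k<m. ns k) = n \<and> (\<forall>k<m. c k = of_nat (ns k))"
    using all sum AE_space
  proof eventually_elim
    case (elim x)
    have Ax: "A x \<in> carrier_mat n n" using Linf_mat_carrier[OF A elim(3)] .
    have Px: "P k x \<in> carrier_mat n n" if "k < m" for k using Linf_mat_carrier[OF P[OF that] elim(3)] .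
    have "\<exists>r. c k = of_nat r" if k: "k < m" for k
    proof -
      have p: "P k x * P k x = P k x" "A x * P k x = P k x * A x" "mat_trace (P k x) = c k"
        using elim(1) k by auto
      \<comment> \<open>Any finite bound will do here, since only the factorisation at this one
        point is used.\<close>
      have bd: "norm (P k x $$ (i, j)) \<le> (\<Sum>i<n. \<Sum>j<n. norm (P k x $$ (i, j)))" if "i < n" "j < n" for i j
      proof -
        have "norm (P k x $$ (i, j)) \<le> (\<Sum>j<n. norm (P k x $$ (i, j)))"
          using that by (intro member_le_sum) auto
        also have "\<dots> \<le> (\<Sum>i<n. \<Sum>j<n. norm (P k x $$ (i, j)))"
          using that member_le_sum[of i "{..<n}" "\<lambda>i. \<Sum>j<n. norm (P k x $$ (i, j))"]
          by (auto simp: sum_nonneg)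
        finally show ?thesis .
      qed
      obtain r X Y where XY: "X \<in> carrier_mat r n" "Y \<in> carrier_mat n r" "X * Y = 1\<^sub>m r" "Y * X = P k x"
        by (rule bounded_triangularization_of_range[OF Ax Px[OF k] p(1,2) bd])
      have "c k = of_nat r"
        using mat_trace_mult_commute[OF XY(1,2)] XY(3,4) p(3) by (simp add: mat_trace_one)
      then show ?thesis by blast
    qed
    then obtain ns where ns: "\<And>k. k < m \<Longrightarrow> c k = of_nat (ns k)" by metis
    have "of_nat n = mat_trace (mat n n (\<lambda>(i, j). \<Sum>k<m. P k x $$ (i, j)))"
      unfolding elim(2) mat_trace_one ..
    also have "\<dots> = (\<Sum>i<n. \<Sum>k<m. P k x $$ (i, i))" by (simp add: mat_trace_def)
    also have "\<dots> = (\<Sum>k<m. \<Sum>i<n. P k x $$ (i, i))" by (rule sum.swap)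
    also have "\<dots> = (\<Sum>k<m. mat_trace (P k x))"
      using Px by (intro sum.cong) (auto simp: mat_trace_def)
    also have "\<dots> = (\<Sum>k<m. of_nat (ns k))" using elim(1) ns by (intro sum.cong) auto
    finally have "(of_nat n :: complex) = of_nat (\<Sum>k<m. ns k)" by simp
    then have "(\<Sum>k<m. ns k) = n" by (simp only: of_nat_eq_iff)
    then show ?case using ns by blast
  qed
  moreover have "\<exists>x. Q x" if "AE x in M. Q x" for Q
  proof (rule ccontr)
    assume "\<nexists>x. Q x"
    then have "AE x in M. False" using that by simp
    then show False using False by simp
  qed
  ultimately obtain ns where ns: "(\<Sum>k<m. ns k) = n" "\<forall>k<m. c k = of_nat (ns k)" by blast
  show thesis
  proof (rule that[OF ns(1)])
    show "AE x in M. mat_trace (P k x) = of_nat (ns k)" if "k < m" for k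
      using c[OF that] ns(2) that by simp
  qed
qed

theorem proposition2p8:
  fixes \<Lambda> :: "complex set" and \<nu> \<mu> :: "complex measure" and n m :: nat
    and A :: "complex \<Rightarrow> complex mat" and P :: "nat \<Rightarrow> complex \<Rightarrow> complex mat"
  assumes "finite_regular_borel_on \<Lambda> \<nu>" and "\<mu> = completion \<nu>"
    and "1 \<le> n"
    and "A \<in> Linf_mat \<mu> n"
    and "finite_frame \<Lambda> \<mu> n A m P"
    and "\<forall>k<m. \<exists>c. AE x in \<mu>. x \<in> \<Lambda> \<longrightarrow> mat_trace (P k x) = c"
  shows "\<exists>X Y (ns :: nat \<Rightarrow> nat) (As :: nat \<Rightarrow> complex \<Rightarrow> complex mat).
    Linf_inverse \<mu> n X Y \<and>
    (\<forall>k<m. As k \<in> Linf_mat \<mu> (ns k)) \<and>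
    (AE x in \<mu>. X x * A x * Y x = diag_block_mat (map (\<lambda>k. As k x) [0..<m])) \<and>
    (\<forall>k<m. AE x in \<mu>. upper_triangular (As k x)) \<and>
    (\<forall>k<m. 0 < ns k \<or> (AE x in \<mu>. P k x = 0\<^sub>m n n)) \<and>
    (\<Sum>k<m. ns k) = n \<and>
    (\<forall>k<m. \<forall>j. 1 \<le> j \<and> j < ns k \<longrightarrow> (AE x in \<mu>. As k x $$ (j, j) = As k x $$ (0, 0))) \<and>
    (\<forall>k<m. \<forall>j. Suc j < ns k \<longrightarrow>
       (AE x in \<mu>. x \<in> \<Lambda> \<longrightarrow> As k x $$ (j, Suc j) \<noteq> 0))"
proof -
  note reg = assms(1) and \<mu> = assms(2) and A = assms(4) and frame = assms(5)
  have n: "0 < n" and m: "1 \<le> m" using assms(3) frame by (auto simp: finite_frame_def)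
  have P: "P k \<in> Linf_mat \<mu> n" and comm: "AE x in \<mu>. A x * P k x = P k x * A x"
    and idem: "AE x in \<mu>. P k x * P k x = P k x" if "k < m" for k
    using frame that by (auto simp: finite_frame_def rel_commutant_def idempotent_on_def)
  have orth: "AE x in \<mu>. P i x * P j x = 0\<^sub>m n n" if "i < m" "j < m" "i \<noteq> j" for i j
    using frame that by (auto simp: finite_frame_def frame_items_def)
  have sum: "AE x in \<mu>. mat n n (\<lambda>(i, j). \<Sum>k<m. P k x $$ (i, j)) = 1\<^sub>m n"
    using frame by (simp add: finite_frame_def frame_items_def)
  have "AE x in \<mu>. x \<in> \<Lambda>" unfolding \<mu> by (rule AE_completion_in_support[OF reg])
  then have "\<exists>c. AE x in \<mu>. mat_trace (P k x) = c" if k: "k < m" for k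
  proof -
    obtain c where "AE x in \<mu>. x \<in> \<Lambda> \<longrightarrow> mat_trace (P k x) = c" using assms(6) k by blast
    then have "AE x in \<mu>. mat_trace (P k x) = c"
      using \<open>AE x in \<mu>. x \<in> \<Lambda>\<close> by eventually_elim blast
    then show ?thesis by blast
  qed
  then obtain ns where ns: "(\<Sum>k<m. ns k) = n"
    and tr: "\<And>k. k < m \<Longrightarrow> AE x in \<mu>. mat_trace (P k x) = of_nat (ns k)"
    using exists_constant_ranks[OF A P idem comm sum _ m] by blast
  define block where "block k X Y \<longleftrightarrow>
      (\<forall>x. X x \<in> carrier_mat (ns k) n) \<and> (\<forall>x. Y x \<in> carrier_mat n (ns k)) \<and>
      (\<forall>i j. i < ns k \<longrightarrow> j < n \<longrightarrow> (\<lambda>x. X x $$ (i, j)) \<in> Linf \<mu>) \<and>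
      (\<forall>i j. i < n \<longrightarrow> j < ns k \<longrightarrow> (\<lambda>x. Y x $$ (i, j)) \<in> Linf \<mu>) \<and>
      (AE x in \<mu>. triangularizes n (ns k) (A x) (P k x) (X x) (Y x))" for k X Y
  have "\<exists>X Y. block k X Y" if k: "k < m" for k
  proof (rule measurable_triangularization[OF A P[OF k] idem[OF k] comm[OF k] tr[OF k]])
    fix X Y
    assume "\<And>x. X x \<in> carrier_mat (ns k) n" "\<And>x. Y x \<in> carrier_mat n (ns k)"
      "\<And>i j. i < ns k \<Longrightarrow> j < n \<Longrightarrow> (\<lambda>x. X x $$ (i, j)) \<in> Linf \<mu>"
      "\<And>i j. i < n \<Longrightarrow> j < ns k \<Longrightarrow> (\<lambda>x. Y x $$ (i, j)) \<in> Linf \<mu>"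
      "AE x in \<mu>. triangularizes n (ns k) (A x) (P k x) (X x) (Y x)"
    then have "block k X Y" unfolding block_def by simp
    then show "\<exists>X Y. block k X Y" by blast
  qed
  then obtain X Y where block: "\<And>k. k < m \<Longrightarrow> block k (X k) (Y k)" by metis
  have X: "X k x \<in> carrier_mat (ns k) n" and Y: "Y k x \<in> carrier_mat n (ns k)"
    and tri: "AE x in \<mu>. triangularizes n (ns k) (A x) (P k x) (X k x) (Y k x)"
    if "k < m" for k x
    using block[OF that] unfolding block_def by auto
  have XL: "(\<lambda>x. X k x $$ (i, j)) \<in> Linf \<mu>" if "k < m" "i < ns k" "j < n" for k i j
    using block[OF that(1)] that unfolding block_def by blast
  have YL: "(\<lambda>x. Y k x $$ (i, j)) \<in> Linf \<mu>" if "k < m" "i < n" "j < ns k" for k i j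
    using block[OF that(1)] that unfolding block_def by blast
  define T where "T k x = X k x * A x * Y k x" for k x
  define XX where "XX x = stack_rows n m (\<lambda>k. X k x)" for x
  define YY where "YY x = stack_cols n m (\<lambda>k. Y k x)" for x
  \<comment> \<open>The ranks add up to \<open>n\<close>, so the stacked matrices are
    square.\<close>
  have XXc: "XX x \<in> carrier_mat n n" for x
    using stack_rows_carrier[of m "\<lambda>k. X k x" ns n] X ns by (simp add: XX_def)
  have YYc: "YY x \<in> carrier_mat n n" for x
    using stack_cols_carrier[of m "\<lambda>k. Y k x" n ns] Y ns by (simp add: YY_def)
  have tri_all: "AE x in \<mu>. \<forall>k\<in>{..<m}. triangularizes n (ns k) (A x) (P k x) (X k x) (Y k x)"
    using tri by (intro AE_finite_allI) auto
  have comm_all: "AE x in \<mu>. \<forall>k\<in>{..<m}. A x * P k x = P k x * A x"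
    using comm by (intro AE_finite_allI) auto
  have orth_all: "AE x in \<mu>. \<forall>i\<in>{..<m}. \<forall>j\<in>{..<m}. i \<noteq> j \<longrightarrow> P i x * P j x = 0\<^sub>m n n"
    using orth by (intro AE_finite_allI) auto
  \<comment> \<open>Only \<open>YY x * XX x\<close> is computed; for square matrices a one-sided
    inverse is two-sided.\<close>
  have inv: "AE x in \<mu>. inverts_mat (XX x) (YY x) \<and> inverts_mat (YY x) (XX x)"
    using tri_all sum
  proof eventually_elim
    case (elim x)
    have "YY x * XX x = mat n n (\<lambda>(i, j). \<Sum>k<m. (Y k x * X k x) $$ (i, j))"
      unfolding XX_def YY_def by (rule stack_cols_mult_stack_rows[OF X Y])
    also have "\<dots> = mat n n (\<lambda>(i, j). \<Sum>k<m. P k x $$ (i, j))"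
      using elim(1) by (intro cong_mat) (auto simp: triangularizes_def)
    finally have "YY x * XX x = 1\<^sub>m n" using elim(2) by simp
    then show ?case
      using mat_mult_left_right_inverse[OF YYc XXc] XXc[of x] YYc[of x] by (auto simp: inverts_mat_def)
  qed
  have "(\<lambda>x. XX x $$ (i, j)) \<in> Linf \<mu>" if "i < n" "j < n" for i j
    unfolding XX_def using X XL ns that by (intro stack_rows_Linf[where ns = ns]) simp_all
  then have XXL: "XX \<in> Linf_mat \<mu> n" using XXc by (simp add: Linf_mat_def)
  have "(\<lambda>x. YY x $$ (i, j)) \<in> Linf \<mu>" if "i < n" "j < n" for i j
    unfolding YY_def using Y YL ns that by (intro stack_cols_Linf[where ns = ns]) simp_all
  then have YYL: "YY \<in> Linf_mat \<mu> n" using YYc by (simp add: Linf_mat_def)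
  have TL: "T k \<in> Linf_mat \<mu> (ns k)" if k: "k < m" for k
  proof -
    have "space \<mu> = UNIV"
      using reg sets_eq_imp_space_eq[of \<nu> borel] by (simp add: \<mu> finite_regular_borel_on_def)
    then have Ax: "A x \<in> carrier_mat n n" for x using Linf_mat_carrier[OF A, of x] by simp
    have Tx: "T k x \<in> carrier_mat (ns k) (ns k)" for x
      unfolding T_def using X[OF k, of x] Ax[of x] Y[OF k, of x] by simp
    have "(\<lambda>x. T k x $$ (i, j)) \<in> Linf \<mu>" if ij: "i < ns k" "j < ns k" for i j
    proof -
      have "T k x $$ (i, j) = (\<Sum>l<n. (\<Sum>p<n. X k x $$ (i, p) * A x $$ (p, l)) * Y k x $$ (l, j))" for x
        unfolding T_def mult_entry[OF mult_carrier_mat[OF X[OF k] Ax] Y[OF k] ij]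
        using ij by (intro sum.cong refl) (simp add: mult_entry[OF X[OF k] Ax] del: index_mult_mat(1))
      moreover have "(\<lambda>x. A x $$ (p, l)) \<in> Linf \<mu>" if "p < n" "l < n" for p l
        using A that by (simp add: Linf_mat_def)
      ultimately show ?thesis
        using XL[OF k ij(1)] YL[OF k _ ij(2)] by (auto intro!: Linf_sum Linf_mult)
    qed
    then show ?thesis using Tx by (simp add: Linf_mat_def)
  qed
  have diag: "AE x in \<mu>. XX x * A x * YY x = diag_block_mat (map (\<lambda>k. T k x) [0..<m])"
    using tri_all comm_all orth_all AE_space
  proof eventually_elim
    case (elim x)
    have Ax: "A x \<in> carrier_mat n n" by (rule Linf_mat_carrier[OF A elim(4)])
    show ?case
      unfolding XX_def YY_def T_def
    proof (rule stack_rows_mult_stack_cols[OF Ax X Y])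
      \<comment> \<open>Off the diagonal, \<open>X i\<close> absorbs \<open>P i\<close> on its right
        and \<open>Y j\<close> absorbs \<open>P j\<close> on its left; \<open>P i\<close> moves past
        \<open>A\<close> and meets \<open>P j\<close>, with product 0.\<close>
      fix i j assume ij: "i < m" "j < m" "i \<noteq> j"
      note Xi = X[OF ij(1), of x] and Yi = Y[OF ij(1), of x]
        and Xj = X[OF ij(2), of x] and Yj = Y[OF ij(2), of x]
      have Pi: "P i x \<in> carrier_mat n n" and Pj: "P j x \<in> carrier_mat n n"
        using Linf_mat_carrier[OF P elim(4)] ij by auto
      have t: "X i x * Y i x = 1\<^sub>m (ns i)" "Y i x * X i x = P i x"
        "X j x * Y j x = 1\<^sub>m (ns j)" "Y j x * X j x = P j x"
        using elim(1) ij by (auto simp: triangularizes_def)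
      have XP: "X i x * P i x = X i x" using assoc_mult_mat[OF Xi Yi Xi] t Xi by simp
      have PY: "P j x * Y j x = Y j x" using assoc_mult_mat[OF Yj Xj Yj] t Yj by simp
      have PA: "P i x * A x = A x * P i x" using elim(2) ij by simp
      have AY: "A x * Y j x \<in> carrier_mat n (ns j)" using Ax Yj by simp
      have PP: "P i x * Y j x = 0\<^sub>m n (ns j)"
        using assoc_mult_mat[OF Pi Pj Yj] PY elim(3) ij Yj by simp
      have "X i x * (A x * Y j x) = X i x * (P i x * (A x * Y j x))"
        using assoc_mult_mat[OF Xi Pi AY] XP by simp
      also have "P i x * (A x * Y j x) = A x * (P i x * Y j x)"
        using assoc_mult_mat[OF Pi Ax Yj] assoc_mult_mat[OF Ax Pi Yj] PA by simp
      also have "\<dots> = 0\<^sub>m n (ns j)" using PP Ax by simp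
      also have "X i x * 0\<^sub>m n (ns j) = 0\<^sub>m (ns i) (ns j)" using Xi by simp
      finally show "X i x * (A x * Y j x) = 0\<^sub>m (ns i) (ns j)" .
    qed
  qed
  have ut: "AE x in \<mu>. upper_triangular (T k x)" if k: "k < m" for k
    using tri[OF k] by eventually_elim (simp add: triangularizes_def T_def)
  \<comment> \<open>An empty block arises only from a \<open>P k\<close> that vanishes almost
    everywhere, because \<open>Y k x * X k x\<close> then factors through dimension 0.\<close>
  have nz: "0 < ns k \<or> (AE x in \<mu>. P k x = 0\<^sub>m n n)" if k: "k < m" for k
  proof (cases "ns k = 0")
    case True
    have "AE x in \<mu>. P k x = 0\<^sub>m n n"
      using tri[OF k]
    proof eventually_elim
      case (elim x)
      then have "P k x = Y k x * X k x" by (simp add: triangularizes_def)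
      also have "\<dots> = 0\<^sub>m n n"
        using X[OF k, of x] Y[OF k, of x] True by (intro eq_matI) (auto simp: scalar_prod_def)
      finally show ?case .
    qed
    then show ?thesis ..
  qed simp
  have fin: "AE x in \<mu>. (\<forall>j<ns k. T k x $$ (j, j) = T k x $$ (0, 0)) \<and>
      (\<forall>j. Suc j < ns k \<longrightarrow> T k x $$ (j, Suc j) \<noteq> 0)" if k: "k < m" for k
    using tri[OF k] comm[OF k] AE_frame_element_indecomposable[OF reg \<mu> n A frame k] AE_space
  proof eventually_elim
    case (elim x)
    have Ax: "A x \<in> carrier_mat n n" by (rule Linf_mat_carrier[OF A elim(4)])
    show ?case
      using triangularizes_indecomposable[OF Ax elim(2,1,3)] unfolding T_def by blast
  qed
  have "Linf_inverse \<mu> n XX YY" using XXL YYL inv by (simp add: Linf_inverse_def)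
  moreover have "AE x in \<mu>. T k x $$ (j, j) = T k x $$ (0, 0)" if "k < m" "1 \<le> j \<and> j < ns k" for k j
    using fin[OF that(1)] by eventually_elim (use that in blast)
  moreover have "AE x in \<mu>. x \<in> \<Lambda> \<longrightarrow> T k x $$ (j, Suc j) \<noteq> 0" if "k < m" "Suc j < ns k" for k j
    using fin[OF that(1)] by eventually_elim (use that in blast)
  ultimately show ?thesis
    using TL diag ut nz ns by (intro exI[of _ XX] exI[of _ YY] exI[of _ ns] exI[of _ T]) blast
qed

end
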